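(* Let $p\in(1,2)$. Given $a>0$ there is a unique solution $f(\cdot,a)$ to the initial value problem $$(|f'|^{p-2}f')'+f-|f'|^{p-1}=0,\quad r\in(0,\infty),\qquad f(0,a)=a,\quad f'(0,a)=0,$$ and $$R(a):=\inf\{r>0 : f(r,a)=0\}\in(0,\infty].$$ Furthermore, there is $a_*>0$ (depending on $p$ only) with the following properties: \begin{itemize} \item[(a)] if $a>a_*$, then $R(a)<\infty$, $f(R(a),a)=0$, and $f'(R(a),a)<0$; \item[(b)] if $a=a_*$, then $R(a_* )=\infty$ and there is $\ell_*>0$ such that $\lim_{r\to\infty}e^{r/(p-1)}f(r,a_* )=\ell_*$; \item[(c)] if $a\in(0,a_* )$, then $R(a)=\infty$ and $$\lim_{r\to\infty}r^{(p-1)/(2-p)}f(r,a)=\left(\frac{p-1}{2-p}\right)^{(p-1)/(2-p)}.$$ \end{itemize}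
   Context: Here $f'$ denotes the derivative with respect to $r$. A solution to the initial value problem is a real-valued function $f\in C^1([0,\infty))$ such that $|f'|^{p-2}f'\in C^1([0,\infty))$ (with $|z|^{p-2}z:=0$ for $z=0$), satisfying the equation and the initial conditions. The convention $\inf\emptyset=\infty$ is used. *)

theory Defs
  imports "HOL-Analysis.Analysis"
begin

text \<open>Functions on the half-line \<open>[0,\<infinity>)\<close> are total functions whose values at negative arguments
  are irrelevant: all derivatives are taken within \<open>{0..}\<close>, hence are one-sided at \<open>0\<close> and
  ordinary two-sided derivatives at positive arguments.\<close>

definition hderiv :: "(real \<Rightarrow> real) \<Rightarrow> real \<Rightarrow> real" where
  "hderiv f r = vector_derivative f (at r within {0..})"

definition C1_halfline :: "(real \<Rightarrow> real) \<Rightarrow> bool" where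
  "C1_halfline f \<longleftrightarrow> f differentiable_on {0..} \<and> continuous_on {0..} (hderiv f)"

text \<open>At \<open>z = 0\<close> the value is \<open>0\<close>, as required, because of the factor \<open>z\<close>.\<close>

definition p_power :: "real \<Rightarrow> real \<Rightarrow> real" where
  "p_power p z = \<bar>z\<bar> powr (p - 2) * z"

definition ivp_solution :: "real \<Rightarrow> real \<Rightarrow> (real \<Rightarrow> real) \<Rightarrow> bool" where
  "ivp_solution p a f \<longleftrightarrow>
     C1_halfline f \<and>
     C1_halfline (\<lambda>r. p_power p (hderiv f r)) \<and>
     (\<forall>r>0. hderiv (\<lambda>s. p_power p (hderiv f s)) r + f r - \<bar>hderiv f r\<bar> powr (p - 1) = 0) \<and>
     f 0 = a \<and> hderiv f 0 = 0"

text \<open>The infimum is taken in \<^typ>\<open>ereal\<close>, so it is \<open>\<infinity>\<close> if there is no positive zero.\<close>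

definition first_zero :: "(real \<Rightarrow> real) \<Rightarrow> ereal" where
  "first_zero f = Inf (ereal ` {r. r > 0 \<and> f r = 0})"

end

theory Submission
  imports Defs
begin

text \<open>
  Put \<open>m = 1 / (p - 1) > 1\<close> and \<open>w = - \<bar>f'\<bar> powr (p - 2) * f'\<close>. The equation becomes the planar
  autonomous system

    \<open>f' = - \<bar>w\<bar> powr (m - 1) * w\<close>,  \<open>w' = f - \<bar>w\<bar>\<close>,  \<open>f 0 = a\<close>,  \<open>w 0 = 0\<close>,

  whose right-hand side is locally Lipschitz because \<open>m > 1\<close>: passing to \<open>w\<close> removes the singularity
  of the \<open>p\<close>-Laplacian. The energy \<open>f\<^sup>2 / 2 + \<bar>w\<bar> powr (m + 1) / (m + 1)\<close> grows at most exponentially,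
  so solutions are global (\<open>trajectory_exists\<close>), and Gronwall's inequality gives uniqueness and
  continuity in \<open>a\<close> (\<open>trajectory_dependence\<close>).

  As long as \<open>f > 0\<close> one has \<open>w > 0\<close>. The origin is a degenerate equilibrium, with
  eigenvalues \<open>0\<close> (direction \<open>w = f\<close>) and \<open>- 1\<close> (direction \<open>f = 0\<close>). A trajectory in the open first
  quadrant can do three things:
  leave through \<open>f = 0\<close> with \<open>w > 0\<close>, which is case (a); approach the origin along the stable
  direction, with \<open>w\<close> comparable to \<open>exp (- t)\<close> and hence \<open>f\<close> comparable to \<open>exp (- m * t)\<close>, which is
  case (b); or approach it along the diagonal, where \<open>f' = - f powr m\<close> to leading order, which is
  case (c). The last case is recognised by a trap: once \<open>f\<close> and \<open>w\<close> are small and \<open>w < 2 * f\<close>,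
  this persists for ever (\<open>trapped_forever\<close>), and \<open>w / f\<close> tends to \<open>1\<close>
  (\<open>positive_slow_decay\<close>). A positive trajectory that is never trapped
  satisfies \<open>2 * f \<le> w\<close> eventually, and this forces the exponential decay (\<open>positive_fast_decay\<close>).

  The threshold comes from comparing orbits. If the trajectory from \<open>b\<close> stays positive, its energy can
  be read as a function of \<open>f\<close>. For a trajectory from \<open>a < b\<close>, the energy gap \<open>\<Delta>\<close> at equal
  values of \<open>f\<close> satisfies \<open>\<Delta>' \<ge> - \<Delta>\<close>, by convexity of \<open>z powr (m + 1)\<close>. Hence \<open>\<Delta>\<close> is at
  least a multiple of \<open>exp (- t)\<close>, whereas it is at most of order \<open>f powr ((m + 1) / m)\<close>. This excludes
  both a zero of \<open>f\<close> and the decay \<open>exp (- m * t)\<close> (\<open>below_positive_trapped\<close>): everything below a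
  positive trajectory is trapped. So \<open>a_star\<close>, the supremum of the initial values with positive
  trajectories, separates (c) from (a). Hitting zero and being trapped are both
  open conditions on \<open>a\<close>, so at \<open>a_star\<close> neither happens and (b) is the only possibility left.
  The supremum is positive because small values are trapped at time \<open>0\<close>, and it is finite because
  for large \<open>a\<close> the dissipated energy is too small for the trajectory to reach the
  origin (\<open>positive_initial_bounded\<close>).
\<close>

section \<open>Signed powers\<close>

text \<open>Power functions are differentiated at \<open>0\<close> by this comparison, since the chain rule for \<open>powr\<close>
covers nonzero bases only.\<close>
lemma abs_powr_le_imp_DERIV_zero:
  fixes g :: "real \<Rightarrow> real"
  assumes "1 < b" and "\<And>h. \<bar>g h\<bar> \<le> C * \<bar>h\<bar> powr b"
  shows "DERIV g 0 :> 0"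
proof -
  have g0: "g 0 = 0" using assms(2)[of 0] by simp
  have lim: "((\<lambda>h::real. C * \<bar>h\<bar> powr (b - 1)) \<longlongrightarrow> 0) (at 0)"
  proof -
    have "((\<lambda>h::real. C * \<bar>h\<bar> powr (b - 1)) \<longlongrightarrow> C * 0) (at 0)"
    proof (intro tendsto_mult tendsto_const)
      have "((\<lambda>h::real. \<bar>h\<bar> powr (b - 1)) \<longlongrightarrow> 0 powr (b - 1)) (at 0)"
        using assms(1)
        by (intro tendsto_powr2 tendsto_rabs_zero tendsto_const tendsto_ident_at) auto
      then show "((\<lambda>h::real. \<bar>h\<bar> powr (b - 1)) \<longlongrightarrow> 0) (at 0)" by simp
    qed
    then show ?thesis by simp
  qed
  have "((\<lambda>h. (g (0 + h) - g 0) / h) \<longlongrightarrow> 0) (at 0)"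
  proof (rule Lim_null_comparison[OF _ lim])
    show "\<forall>\<^sub>F h in at 0. norm ((g (0 + h) - g 0) / h) \<le> C * \<bar>h\<bar> powr (b - 1)"
    proof (rule eventually_at_topological[THEN iffD2], intro exI[of _ UNIV] conjI ballI impI)
      fix h :: real assume "h \<noteq> 0"
      then have "\<bar>g h\<bar> / \<bar>h\<bar> \<le> C * \<bar>h\<bar> powr b / \<bar>h\<bar>"
        by (intro divide_right_mono assms(2)) auto
      also have "\<dots> = C * \<bar>h\<bar> powr (b - 1)"
        using \<open>h \<noteq> 0\<close> by (simp add: powr_diff)
      finally show "norm ((g (0 + h) - g 0) / h) \<le> C * \<bar>h\<bar> powr (b - 1)"
        by (simp add: g0)
    qed auto
  qed
  then show ?thesis by (simp add: DERIV_def)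
qed

lemma p_power_zero [simp]: "p_power b 0 = 0"
  by (simp add: p_power_def)

lemma p_power_pos: "0 < z \<Longrightarrow> p_power b z = z powr (b - 1)"
  using powr_add[of z "b - 2" 1] by (simp add: p_power_def add.commute)

lemma p_power_minus [simp]: "p_power b (- z) = - p_power b z"
  by (simp add: p_power_def)

lemma abs_p_power:
  assumes "z \<noteq> 0"
  shows "\<bar>p_power b z\<bar> = \<bar>z\<bar> powr (b - 1)"
proof -
  have pos: "\<bar>p_power b x\<bar> = \<bar>x\<bar> powr (b - 1)" if "0 < x" for x
    using that by (simp add: p_power_pos)
  show ?thesis
    using pos[of z] pos[of "- z"] assms by (cases "0 < z") auto
qed

text \<open>Conjugate exponents give mutually inverse signed powers; this is what turns the second-order equation
into a first-order system.\<close>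
lemma p_power_inverse:
  assumes "(b - 1) * (c - 1) = 1"
  shows "p_power c (p_power b z) = z"
proof -
  have pos: "p_power c (p_power b z) = z" if "0 < z" for z
    using that assms by (simp add: p_power_pos powr_powr)
  consider "z > 0" | "z = 0" | "- z > 0" by linarith
  then show ?thesis
    using pos[of z] pos[of "- z"] by cases (simp_all del: neg_0_less_iff_less)
qed

lemma DERIV_abs_powr:
  assumes "1 < b"
  shows "DERIV (\<lambda>z::real. \<bar>z\<bar> powr b) z :> b * p_power b z"
proof -
  consider "z > 0" | "z = 0" | "z < 0" by linarith
  then show ?thesis
  proof cases
    case 1
    have "DERIV (\<lambda>z. z powr b) z :> b * z powr (b - 1)"
      using 1 by (auto intro!: derivative_eq_intros simp: powr_diff)
    then show ?thesis
      using 1 by (subst p_power_pos, simp)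
        (rule has_field_derivative_transform_within_open[where S = "{0<..}"], auto)
  next
    case 2
    then show ?thesis
      using abs_powr_le_imp_DERIV_zero[OF assms, of "\<lambda>z. \<bar>z\<bar> powr b" 1] by simp
  next
    case 3
    have "DERIV (\<lambda>z. (- z) powr b) z :> - (b * (- z) powr (b - 1))"
      using 3 by (auto intro!: derivative_eq_intros simp: powr_diff)
    moreover have "p_power b z = - ((- z) powr (b - 1))"
      using p_power_pos[of "- z" b] 3 by simp
    ultimately show ?thesis
      using 3 by simp
        (rule has_field_derivative_transform_within_open[where S = "{..<0}"], auto)
  qed
qed

lemma DERIV_p_power:
  assumes "1 < m"
  shows "DERIV (p_power (m + 1)) z :> m * \<bar>z\<bar> powr (m - 1)"
proof -
  consider "z > 0" | "z = 0" | "z < 0" by linarith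
  then show ?thesis
  proof cases
    case 1
    have "DERIV (\<lambda>z. z powr m) z :> m * z powr (m - 1)"
      using 1 by (auto intro!: derivative_eq_intros simp: powr_diff)
    then show ?thesis
      using 1 by simp
        (rule has_field_derivative_transform_within_open[where S = "{0<..}"], auto simp: p_power_pos)
  next
    case 2
    have "\<bar>p_power (m + 1) h\<bar> \<le> 1 * \<bar>h\<bar> powr m" for h
      by (cases "h = 0") (simp_all add: abs_p_power)
    then show ?thesis
      using 2 assms abs_powr_le_imp_DERIV_zero[OF assms, of "p_power (m + 1)" 1] by simp
  next
    case 3
    have d: "DERIV (\<lambda>z. - ((- z) powr m)) z :> m * (- z) powr (m - 1)"
      using 3 by (auto intro!: derivative_eq_intros simp: powr_diff)
    have e: "- ((- x) powr m) = p_power (m + 1) x" if "x < 0" for x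
      using p_power_pos[of "- x" "m + 1"] that by simp
    have "DERIV (p_power (m + 1)) z :> m * (- z) powr (m - 1)"
      using 3 e by (intro has_field_derivative_transform_within_open[OF d open_lessThan[of 0]]) auto
    then show ?thesis using 3 by simp
  qed
qed

lemma p_power_lipschitz:
  assumes "1 < m" "\<bar>x\<bar> \<le> M" "\<bar>y\<bar> \<le> M"
  shows "\<bar>p_power (m + 1) x - p_power (m + 1) y\<bar> \<le> m * M powr (m - 1) * \<bar>x - y\<bar>"
proof -
  have "norm (p_power (m + 1) x - p_power (m + 1) y) \<le> m * M powr (m - 1) * norm (x - y)"
  proof (rule field_differentiable_bound[where S = "{- M..M}"])
    fix z assume "z \<in> {- M..M}"
    then show "norm (m * \<bar>z\<bar> powr (m - 1)) \<le> m * M powr (m - 1)"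
      using assms by (auto simp: abs_mult intro!: mult_left_mono powr_mono2)
  qed (use assms DERIV_p_power in \<open>auto intro: has_field_derivative_at_within\<close>)
  then show ?thesis by simp
qed

lemma continuous_on_p_power [continuous_intros]:
  assumes "1 < m" "continuous_on S g"
  shows "continuous_on S (\<lambda>x. p_power (m + 1) (g x))"
proof -
  have "continuous_on UNIV (p_power (m + 1))"
    using DERIV_p_power[OF assms(1)] by (intro DERIV_continuous_on) auto
  from continuous_on_compose2[OF this assms(2)] show ?thesis by auto
qed

section \<open>Monotonicity and barriers\<close>

lemma nondecreasing_if_DERIV_nonneg:
  fixes u u' :: "real \<Rightarrow> real"
  assumes "s \<le> t" "continuous_on {s..t} u"
    and "\<And>x. s < x \<Longrightarrow> x < t \<Longrightarrow> DERIV u x :> u' x" "\<And>x. s < x \<Longrightarrow> x < t \<Longrightarrow> 0 \<le> u' x"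
  shows "u s \<le> u t"
  by (rule DERIV_nonneg_imp_increasing_open) (use assms in blast)+

lemma nonincreasing_if_DERIV_nonpos:
  fixes u u' :: "real \<Rightarrow> real"
  assumes "s \<le> t" "continuous_on {s..t} u"
    and "\<And>x. s < x \<Longrightarrow> x < t \<Longrightarrow> DERIV u x :> u' x" "\<And>x. s < x \<Longrightarrow> x < t \<Longrightarrow> u' x \<le> 0"
  shows "u t \<le> u s"
  by (rule DERIV_nonpos_imp_decreasing_open) (use assms in blast)+

lemma limit_le_if_DERIV_nonpos:
  fixes u u' :: "real \<Rightarrow> real"
  assumes lim: "(u \<longlongrightarrow> l) at_top"
    and "\<And>t. s \<le> t \<Longrightarrow> DERIV u t :> u' t" "\<And>t. s \<le> t \<Longrightarrow> u' t \<le> 0"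
  shows "l \<le> u s"
proof (rule tendsto_upperbound[OF lim])
  show "\<forall>\<^sub>F t in at_top. u t \<le> u s"
    using eventually_ge_at_top[of s]
  proof eventually_elim
    case (elim t)
    then show ?case
      by (rule DERIV_nonpos_imp_nonincreasing) (use assms(2,3) in blast)
  qed
qed simp

text \<open>A function with positive derivative wherever it is nonpositive cannot become nonpositive: it would
attain its minimum over \<open>[s, t]\<close> at a point to the left of which it takes smaller values. Equality
\<open>u s = 0\<close> is admitted, which is needed for \<open>w 0 = 0\<close>.\<close>
lemma positive_by_barrier:
  fixes u :: "real \<Rightarrow> real"
  assumes cont: "continuous_on {s..T} u" and s: "0 \<le> u s"
    and barrier: "\<And>t. s < t \<Longrightarrow> t \<le> T \<Longrightarrow> u t \<le> 0 \<Longrightarrow> \<exists>d>0. DERIV u t :> d"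
    and t: "s < t" "t \<le> T"
  shows "0 < u t"
proof (rule ccontr)
  assume neg: "\<not> 0 < u t"
  have "continuous_on {s..t} u" using continuous_on_subset[OF cont] t by auto
  then obtain c where c: "s \<le> c" "c \<le> t" "\<And>x. s \<le> x \<Longrightarrow> x \<le> t \<Longrightarrow> u c \<le> u x"
    using continuous_attains_inf[of "{s..t}" u] t by auto
  obtain c' where c': "s < c'" "c' \<le> t" "\<And>x. s \<le> x \<Longrightarrow> x \<le> t \<Longrightarrow> u c' \<le> u x"
  proof (cases "s < c")
    case True
    then show ?thesis using that[of c] c by auto
  next
    case False
    then have "u t \<le> u x" if "s \<le> x" "x \<le> t" for x
      using c(1) c(3)[OF that] s neg by force
    then show ?thesis using that[of t] t by auto
  qed
  moreover have "u c' \<le> 0" using c'(3)[of t] t neg by auto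
  ultimately obtain d where "0 < d" "DERIV u c' :> d"
    using barrier[of c'] t by auto
  then obtain e where e: "e > 0" "\<And>h. 0 < h \<Longrightarrow> h < e \<Longrightarrow> u (c' - h) < u c'"
    using DERIV_pos_inc_left by blast
  define h where "h = min (e / 2) (c' - s)"
  have h: "0 < h" "h < e" "h \<le> c' - s" using e c' by (auto simp: h_def)
  then have "u (c' - h) < u c'" by (intro e)
  moreover have "u c' \<le> u (c' - h)" using c' h by (intro c') auto
  ultimately show False by simp
qed

lemma bounded_nondecreasing_tendsto_at_top:
  fixes u :: "real \<Rightarrow> real"
  assumes mono: "\<And>s t. T \<le> s \<Longrightarrow> s \<le> t \<Longrightarrow> u s \<le> u t" and bound: "\<And>t. T \<le> t \<Longrightarrow> u t \<le> M"
  shows "\<exists>l. u T \<le> l \<and> (u \<longlongrightarrow> l) at_top"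
proof -
  define l where "l = (SUP t\<in>{T..}. u t)"
  have bdd: "bdd_above (u ` {T..})" using bound by (auto intro!: bdd_aboveI)
  have le: "u t \<le> l" if "T \<le> t" for t
    unfolding l_def using that bdd by (intro cSUP_upper) auto
  have "(u \<longlongrightarrow> l) at_top"
  proof (rule order_tendstoI)
    fix y assume "y < l"
    then obtain s where s: "T \<le> s" "y < u s"
      unfolding l_def using less_cSUP_iff[OF _ bdd] by auto
    show "\<forall>\<^sub>F t in at_top. y < u t"
      using eventually_ge_at_top[of s]
      by eventually_elim (use s mono in \<open>auto intro: less_le_trans\<close>)
  next
    fix y assume "l < y"
    show "\<forall>\<^sub>F t in at_top. u t < y"
      using eventually_ge_at_top[of T]
      by eventually_elim (use le \<open>l < y\<close> in \<open>auto intro: le_less_trans\<close>)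
  qed
  then show ?thesis using le by blast
qed

lemma first_nonpos_point:
  fixes u :: "real \<Rightarrow> real"
  assumes cont: "continuous_on {s..T} u" and s: "0 < u s" and T: "u T \<le> 0" "s \<le> T"
  shows "\<exists>c. s < c \<and> c \<le> T \<and> u c = 0 \<and> (\<forall>t. s \<le> t \<and> t < c \<longrightarrow> 0 < u t)"
proof -
  define S where "S = {t \<in> {s..T}. u t \<le> 0}"
  have "compact S"
  proof -
    have "closed S"
      using continuous_closed_preimage[OF cont, of "{..0}"] by (simp add: S_def vimage_def Int_def)
    then have "compact ({s..T} \<inter> S)" by (intro compact_Int_closed) auto
    moreover have "{s..T} \<inter> S = S" by (auto simp: S_def)
    ultimately show ?thesis by simp
  qed
  moreover have "T \<in> S" using T by (auto simp: S_def)
  ultimately obtain c where c: "c \<in> S" "\<And>t. t \<in> S \<Longrightarrow> c \<le> t"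
    using compact_attains_inf[of S] by auto
  have pos: "0 < u t" if "s \<le> t" "t < c" for t
    using c that by (force simp: S_def)
  have "continuous_on {s..c} u"
    using continuous_on_subset[OF cont] c by (auto simp: S_def)
  then obtain x where x: "s \<le> x" "x \<le> c" "u x = 0"
    using IVT2'[of u c 0 s] c s by (auto simp: S_def)
  then have "x = c" using pos[of x] by (cases "x < c") auto
  then show ?thesis
    using x c pos s by (intro exI[of _ c]) (auto simp: S_def less_le)
qed

section \<open>Global solutions of Lipschitz systems\<close>

text \<open>Picard's fixed-point argument, with the supremum norm weighted by \<open>exp (- 2 * \<Lambda> t)\<close>. The
Lipschitz constant may grow with time: as \<open>\<Lambda>\<close> is a primitive of \<open>L\<close>, the weighted integral operator
contracts by the factor \<open>1 / 2\<close> on the whole half-line at once.\<close>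
lemma global_ode_solution:
  fixes G :: "real \<Rightarrow> 'a::euclidean_space \<Rightarrow> 'a" and L \<Lambda> :: "real \<Rightarrow> real"
  assumes cont: "continuous_on ({0..} \<times> UNIV) (\<lambda>(t, x). G t x)"
    and lip: "\<And>t x y. 0 \<le> t \<Longrightarrow> norm (G t x - G t y) \<le> L t * norm (x - y)"
    and zero: "\<And>t. 0 \<le> t \<Longrightarrow> G t 0 = 0"
    and Lam: "\<And>t. 0 \<le> t \<Longrightarrow> (\<Lambda> has_real_derivative L t) (at t within {0..})"
    and Lam_nonneg: "\<And>t. 0 \<le> t \<Longrightarrow> 0 \<le> \<Lambda> t"
  shows "\<exists>x. x 0 = x0 \<and> (\<forall>t\<ge>0. (x has_vector_derivative G t (x t)) (at t within {0..}))"
proof -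
  \<comment> \<open>The unknown is \<open>y t = exp (- 2 * \<Lambda> t) *\<^sub>R x t\<close>, which is bounded even if \<open>x\<close> is not.\<close>
  define F where "F y s = G s (exp (2 * \<Lambda> s) *\<^sub>R apply_bcontfun y s)" for y s
  define P where "P y t = exp (- 2 * \<Lambda> t) *\<^sub>R (x0 + integral {0..t} (F y))" for y t
  have contL: "continuous_on {0..} \<Lambda>"
    using Lam DERIV_continuous_on by (metis atLeast_iff)
  have contF: "continuous_on {0..} (F y)" for y
  proof -
    have "continuous_on {0..} (\<lambda>s. (s, exp (2 * \<Lambda> s) *\<^sub>R apply_bcontfun y s))"
      by (intro continuous_intros contL continuous_on_apply_bcontfun)
    from continuous_on_compose2[OF cont this] show ?thesis
      by (auto simp: F_def)
  qed
  have intF: "F y integrable_on {0..t}" for y t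
    by (rule integrable_continuous_real) (rule continuous_on_subset[OF contF], auto)
  have contP: "continuous_on {0..} (P y)" for y
  proof -
    have "continuous (at t within {0..}) (\<lambda>x. integral {0..x} (F y))" if "t \<ge> 0" for t
    proof -
      have "continuous_on {0..t+1} (\<lambda>x. integral {0..x} (F y))"
        by (rule indefinite_integral_continuous_1[OF intF])
      then have "continuous (at t within {0..t+1}) (\<lambda>x. integral {0..x} (F y))"
        using that by (auto simp: continuous_on_eq_continuous_within)
      moreover have "at t within {0..t+1} = at t within {0..}"
        by (rule at_within_nhd[where S = "{..<t+1}"]) auto
      ultimately show ?thesis by simp
    qed
    then have "continuous_on {0..} (\<lambda>x. integral {0..x} (F y))"
      by (simp add: continuous_on_eq_continuous_within)
    then show ?thesis
      unfolding P_def by (intro continuous_intros contL)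
  qed
  have contraction: "norm (P y t - P z t) \<le> dist y z / 2" if t: "t \<ge> 0" for y z t
  proof -
    define g where "g s = L s * exp (2 * \<Lambda> s) * dist y z" for s
    have g: "(g has_integral (exp (2 * \<Lambda> t) * dist y z / 2 - exp (2 * \<Lambda> 0) * dist y z / 2)) {0..t}"
    proof (rule fundamental_theorem_of_calculus[OF t])
      fix s assume s: "s \<in> {0..t}"
      have "(\<Lambda> has_real_derivative L s) (at s within {0..t})"
        using has_field_derivative_subset[OF Lam[of s], of "{0..t}"] s by auto
      then have "((\<lambda>s. exp (2 * \<Lambda> s) * dist y z / 2) has_real_derivative g s) (at s within {0..t})"
        unfolding g_def by (auto intro!: derivative_eq_intros)
      then show "((\<lambda>s. exp (2 * \<Lambda> s) * dist y z / 2) has_vector_derivative g s) (at s within {0..t})"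
        by (simp add: has_real_derivative_iff_has_vector_derivative)
    qed
    have "norm (integral {0..t} (\<lambda>s. F y s - F z s)) \<le> integral {0..t} g"
    proof (rule integral_norm_bound_integral)
      fix s assume s: "s \<in> {0..t}"
      have "norm (F y s - F z s) \<le> L s * norm (exp (2 * \<Lambda> s) *\<^sub>R apply_bcontfun y s - exp (2 * \<Lambda> s) *\<^sub>R apply_bcontfun z s)"
        unfolding F_def using s by (intro lip) auto
      also have "\<dots> = L s * exp (2 * \<Lambda> s) * dist (apply_bcontfun y s) (apply_bcontfun z s)"
        by (simp add: scaleR_diff_right[symmetric] dist_norm)
      also have "\<dots> \<le> g s"
      proof -
        obtain e :: 'a where "norm e = 1" using vector_choose_size[of 1] by auto
        then have "0 \<le> L s" using order_trans[OF norm_ge_zero lip[of s e 0]] s by auto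
        then show ?thesis unfolding g_def by (intro mult_left_mono dist_bounded) auto
      qed
      finally show "norm (F y s - F z s) \<le> g s" .
    qed (use g in \<open>auto intro: integrable_diff intF\<close>)
    also have "integral {0..t} g = (exp (2 * \<Lambda> t) - exp (2 * \<Lambda> 0)) * dist y z / 2"
      using integral_unique[OF g] by (simp add: field_simps)
    also have "\<dots> \<le> exp (2 * \<Lambda> t) * dist y z / 2"
      by (intro divide_right_mono mult_right_mono) auto
    finally have *: "norm (integral {0..t} (F y) - integral {0..t} (F z)) \<le> exp (2 * \<Lambda> t) * dist y z / 2"
      by (simp add: integral_diff intF)
    have "norm (P y t - P z t) = exp (- 2 * \<Lambda> t) * norm (integral {0..t} (F y) - integral {0..t} (F z))"
      unfolding P_def by (simp add: scaleR_diff_right[symmetric])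
    also have "\<dots> \<le> exp (- 2 * \<Lambda> t) * (exp (2 * \<Lambda> t) * dist y z / 2)"
      by (intro mult_left_mono *) auto
    also have "\<dots> = dist y z / 2"
      by (simp add: mult.assoc[symmetric] exp_add[symmetric])
    finally show ?thesis .
  qed
  have bound: "norm (P y t) \<le> norm x0 + dist y 0 / 2" if t: "t \<ge> 0" for y t
  proof -
    have "integral {0..t} (F 0) = integral {0..t} (\<lambda>_. 0)"
      by (rule integral_cong) (auto simp: F_def zero)
    then have "P 0 t = exp (- 2 * \<Lambda> t) *\<^sub>R x0"
      by (simp add: P_def)
    then have "norm (P 0 t) \<le> norm x0"
      using Lam_nonneg[OF t] by (simp add: mult_left_le_one_le)
    with contraction[OF t, of y 0] norm_triangle_sub[of "P y t" "P 0 t"] show ?thesis by linarith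
  qed
  \<comment> \<open>Extending by the value at \<open>0\<close> makes the operator act on functions on the whole line.\<close>
  define T where "T y = Bcontfun (\<lambda>t. P y (max 0 t))" for y
  have T: "apply_bcontfun (T y) t = P y (max 0 t)" for y t
  proof -
    have "(\<lambda>t. P y (max 0 t)) \<in> bcontfun"
    proof (rule bcontfun_normI)
      show "continuous_on UNIV (\<lambda>t. P y (max 0 t))"
        by (rule continuous_on_compose2[OF contP]) (auto intro!: continuous_intros)
      show "norm (P y (max 0 t)) \<le> norm x0 + dist y 0 / 2" for t
        by (rule bound) simp
    qed
    then show ?thesis by (simp add: T_def Bcontfun_inverse)
  qed
  have "\<exists>!y. T y = y"
  proof (rule banach_fix_type[of "1/2"])
    show "\<forall>x y. dist (T x) (T y) \<le> 1 / 2 * dist x y"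
    proof (intro allI dist_bound)
      fix y z t
      show "dist (apply_bcontfun (T y) t) (apply_bcontfun (T z) t) \<le> 1 / 2 * dist y z"
        using contraction[of "max 0 t" y z] by (simp add: T dist_norm[of "P _ _"])
    qed
  qed auto
  then obtain y where y: "T y = y" by auto
  define x where "x t = exp (2 * \<Lambda> t) *\<^sub>R apply_bcontfun y t" for t
  have yP: "apply_bcontfun y t = P y t" if "t \<ge> 0" for t
    using T[of y t] that by (simp add: y)
  have Fx: "F y t = G t (x t)" for t
    by (simp add: F_def x_def)
  have x: "x t = x0 + integral {0..t} (F y)" if "t \<ge> 0" for t
    using that by (simp add: x_def yP P_def exp_add[symmetric])
  have "(x has_vector_derivative G t (x t)) (at t within {0..})" if t: "t \<ge> 0" for t
  proof -
    have "((\<lambda>u. integral {0..u} (F y)) has_vector_derivative F y t) (at t within {0..t+1})"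
      by (rule integral_has_vector_derivative) (use t in \<open>auto intro: continuous_on_subset[OF contF]\<close>)
    then have "((\<lambda>u. x0 + integral {0..u} (F y)) has_vector_derivative F y t) (at t within {0..t+1})"
      by (auto intro!: derivative_eq_intros)
    moreover have "at t within {0..t+1} = at t within {0..}"
      by (rule at_within_nhd[where S = "{..<t+1}"]) auto
    ultimately have "((\<lambda>u. x0 + integral {0..u} (F y)) has_vector_derivative F y t) (at t within {0..})"
      by simp
    then show ?thesis
      unfolding Fx[symmetric]
      by (rule has_vector_derivative_transform[rotated 2]) (use t x in auto)
  qed
  moreover have "x 0 = x0" using x[of 0] by simp
  ultimately show ?thesis by blast
qed

section \<open>The first-order system and its energy\<close>

text \<open>The function \<open>w\<close> stands for \<open>- p_power p f'\<close> with \<open>m = 1 / (p - 1)\<close>. The one-sided derivatives at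
\<open>0\<close> are part of the definition because the initial value problem asks for regularity up to \<open>0\<close>.\<close>
definition trajectory :: "real \<Rightarrow> real \<Rightarrow> (real \<Rightarrow> real) \<Rightarrow> (real \<Rightarrow> real) \<Rightarrow> bool" where
  "trajectory m a f w \<longleftrightarrow> f 0 = a \<and> w 0 = 0 \<and>
     (\<forall>t\<ge>0. (f has_real_derivative - p_power (m + 1) (w t)) (at t within {0..})) \<and>
     (\<forall>t\<ge>0. (w has_real_derivative f t - \<bar>w t\<bar>) (at t within {0..}))"

lemma trajectory_init:
  assumes "trajectory m a f w"
  shows "f 0 = a" "w 0 = 0"
  using assms by (auto simp: trajectory_def)

lemma trajectory_continuous:
  assumes "trajectory m a f w" "S \<subseteq> {0..}"
  shows "continuous_on S f" "continuous_on S w"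
proof -
  have "continuous_on {0..} f" "continuous_on {0..} w"
    using assms(1) unfolding trajectory_def by (auto intro!: DERIV_continuous_on)
  then show "continuous_on S f" "continuous_on S w"
    using assms(2) continuous_on_subset by blast+
qed

lemma at_within_halfline: "0 < t \<Longrightarrow> at t within {0..} = at (t::real)"
  by (rule at_within_interior) auto

lemma trajectory_DERIV:
  assumes "trajectory m a f w" "0 < t"
  shows "DERIV f t :> - p_power (m + 1) (w t)" "DERIV w t :> f t - \<bar>w t\<bar>"
  using assms(1)[unfolded trajectory_def] assms(2)
  by (auto simp flip: at_within_halfline)

definition energy :: "real \<Rightarrow> real \<Rightarrow> real \<Rightarrow> real" where
  "energy m y z = y\<^sup>2 / 2 + \<bar>z\<bar> powr (m + 1) / (m + 1)"

lemma abs_powr_le_energy: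
  assumes "1 < m"
  shows "\<bar>z\<bar> powr (m + 1) \<le> (m + 1) * energy m y z"
proof -
  have "\<bar>z\<bar> powr (m + 1) \<le> (m + 1) * (y\<^sup>2 / 2) + \<bar>z\<bar> powr (m + 1)"
    using assms by simp
  also have "\<dots> = (m + 1) * energy m y z"
    using assms by (simp add: energy_def distrib_left)
  finally show ?thesis .
qed

lemma DERIV_energy:
  assumes m: "1 < m"
    and "DERIV f t :> - p_power (m + 1) (w t)" "DERIV w t :> f t - \<bar>w t\<bar>"
  shows "DERIV (\<lambda>t. energy m (f t) (w t)) t :> - (p_power (m + 1) (w t) * \<bar>w t\<bar>)"
proof -
  have "DERIV (\<lambda>t. \<bar>w t\<bar> powr (m + 1)) t :> (m + 1) * p_power (m + 1) (w t) * (f t - \<bar>w t\<bar>)"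
    using DERIV_chain2[OF DERIV_abs_powr[of "m + 1" "w t"] assms(3)] m by simp
  from DERIV_cdivide[OF this, of "m + 1"]
  have w: "DERIV (\<lambda>t. \<bar>w t\<bar> powr (m + 1) / (m + 1)) t :> p_power (m + 1) (w t) * (f t - \<bar>w t\<bar>)"
    using m by (simp add: mult.assoc)
  have f: "DERIV (\<lambda>t. (f t)\<^sup>2 / 2) t :> f t * (- p_power (m + 1) (w t))"
    using assms(2) by (auto intro!: derivative_eq_intros)
  from DERIV_add[OF f w] have "DERIV (\<lambda>t. energy m (f t) (w t)) t :>
     f t * (- p_power (m + 1) (w t)) + p_power (m + 1) (w t) * (f t - \<bar>w t\<bar>)"
    unfolding energy_def .
  then show ?thesis by (simp add: algebra_simps)
qed

lemma continuous_on_energy: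
  assumes "1 < m" "continuous_on S f" "continuous_on S w"
  shows "continuous_on S (\<lambda>t. energy m (f t) (w t))"
proof -
  have "continuous_on S (\<lambda>t. \<bar>w t\<bar> powr (m + 1))"
    using assms by (intro continuous_on_powr' continuous_intros) auto
  then show ?thesis
    unfolding energy_def using assms(1)
    by (intro continuous_on_add continuous_on_divide continuous_on_power continuous_on_const assms) auto
qed

lemma exp_minus_mult_leD: "exp (- k) * x \<le> y \<Longrightarrow> x \<le> y * exp k" for k x y :: real
  by (simp add: exp_minus field_simps)

text \<open>The energy changes at the rate \<open>- \<bar>w\<bar> powr m * w\<close>, which is positive while \<open>w < 0\<close>; it is
nevertheless bounded by \<open>m + 1\<close> times the energy.\<close>
lemma energy_growth:
  assumes m: "1 < m" and T: "0 \<le> T"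
    and cont: "continuous_on {0..T} f" "continuous_on {0..T} w"
    and der: "\<And>t. 0 < t \<Longrightarrow> t < T \<Longrightarrow> DERIV f t :> - p_power (m + 1) (w t)"
      "\<And>t. 0 < t \<Longrightarrow> t < T \<Longrightarrow> DERIV w t :> f t - \<bar>w t\<bar>"
  shows "energy m (f T) (w T) \<le> energy m (f 0) (w 0) * exp ((m + 1) * T)"
proof -
  have "exp (- ((m + 1) * T)) * energy m (f T) (w T) \<le> exp (- ((m + 1) * 0)) * energy m (f 0) (w 0)"
  proof (rule DERIV_nonpos_imp_decreasing_open[OF T])
    fix t assume t: "0 < t" "t < T"
    have "- (p_power (m + 1) (w t) * \<bar>w t\<bar>) \<le> \<bar>p_power (m + 1) (w t) * \<bar>w t\<bar>\<bar>"
      by simp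
    also have "\<dots> = \<bar>w t\<bar> powr (m + 1)"
      by (cases "w t = 0") (simp_all add: abs_mult abs_p_power powr_add)
    also have "\<dots> \<le> (m + 1) * energy m (f t) (w t)"
      by (rule abs_powr_le_energy[OF m])
    finally have "exp (- ((m + 1) * t)) * (- (p_power (m + 1) (w t) * \<bar>w t\<bar>) - (m + 1) * energy m (f t) (w t)) \<le> 0"
      by (intro mult_nonneg_nonpos) auto
    moreover have "DERIV (\<lambda>t. exp (- ((m + 1) * t)) * energy m (f t) (w t)) t :>
        exp (- ((m + 1) * t)) * (- (p_power (m + 1) (w t) * \<bar>w t\<bar>) - (m + 1) * energy m (f t) (w t))"
      by (rule derivative_eq_intros DERIV_energy[OF m der(1) der(2)] t refl | simp add: algebra_simps)+
    ultimately show "\<exists>y. DERIV (\<lambda>t. exp (- ((m + 1) * t)) * energy m (f t) (w t)) t :> y \<and> y \<le> 0"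
      by blast
  qed (intro continuous_intros continuous_on_energy m cont)
  from exp_minus_mult_leD[OF this] show ?thesis by simp
qed

section \<open>Existence, uniqueness and dependence on the initial value\<close>

lemma powr_inverse_le_iff:
  fixes z M :: real
  assumes "0 < b" "0 \<le> z" "0 \<le> M"
  shows "z \<le> M powr (1 / b) \<longleftrightarrow> z powr b \<le> M"
proof -
  have "M = (M powr (1 / b)) powr b" using assms by (simp add: powr_powr)
  then show ?thesis
    using assms by (metis powr_ge_zero powr_less_mono2 powr_mono2 linorder_not_le order_less_imp_le)
qed

text \<open>The nonlinearity is cut off by restricting its argument to \<open>[- B * exp t, B * exp t]\<close>, which makes
the Lipschitz constant finite at each time. With \<open>B\<close> chosen strictly above the energy bound,
the cut-off is never reached: at the first time of contact the energy
would exceed what \<open>energy_growth\<close> allows.\<close>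
lemma trajectory_exists:
  assumes m: "1 < m"
  shows "\<exists>f w. trajectory m a f w"
proof -
  define B where "B = ((m + 1) * (a\<^sup>2 / 2 + 1)) powr (1 / (m + 1))"
  have "0 < a\<^sup>2 / 2 + 1" by (simp add: add_nonneg_pos)
  then have B0: "0 < B"
    using m unfolding B_def by (simp only: powr_gt_zero) simp
  have "B powr (m + 1) = (m + 1) * (a\<^sup>2 / 2 + 1)"
    using m by (simp add: B_def powr_powr)
  moreover have "(m + 1) * (a\<^sup>2 / 2) < (m + 1) * (a\<^sup>2 / 2 + 1)"
    using m by (intro mult_strict_left_mono) auto
  ultimately have B: "a\<^sup>2 / 2 * (m + 1) < B powr (m + 1)"
    by (simp only: mult.commute)
  define cl where "cl t y = max (- (B * exp t)) (min (B * exp t) y)" for t y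
  define G where "G t x = (- p_power (m + 1) (cl t (snd x)), fst x - \<bar>snd x\<bar>)" for t :: real and x :: "real \<times> real"
  define L where "L t = m * (B * exp t) powr (m - 1) + 2" for t
  define \<Lambda> where "\<Lambda> t = m * B powr (m - 1) / (m - 1) * exp ((m - 1) * t) + 2 * t" for t
  have Bexp: "(B * exp t) powr (m - 1) = B powr (m - 1) * exp ((m - 1) * t)" for t
    using B0 by (simp add: powr_mult exp_powr_real mult.commute)
  have "\<exists>x. x 0 = (a, 0) \<and> (\<forall>t\<ge>0. (x has_vector_derivative G t (x t)) (at t within {0..}))"
  proof (rule global_ode_solution[where L = L and \<Lambda> = \<Lambda>])
    show "continuous_on ({0..} \<times> UNIV) (\<lambda>(t, x). G t x)"
      unfolding G_def cl_def split_beta by (intro continuous_intros m)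
    show "G t 0 = 0" for t
      using B0 by (simp add: G_def cl_def zero_prod_def)
    show "(\<Lambda> has_real_derivative L t) (at t within {0..})" for t
      unfolding \<Lambda>_def L_def Bexp using m by (auto intro!: derivative_eq_intros)
    show "0 \<le> \<Lambda> t" if "0 \<le> t" for t
      using that m B0 by (simp add: \<Lambda>_def)
    show "norm (G t x - G t y) \<le> L t * norm (x - y)" for t x y
    proof -
      have le: "\<bar>fst x - fst y\<bar> \<le> norm (x - y)" "\<bar>snd x - snd y\<bar> \<le> norm (x - y)"
        using norm_fst_le[of "fst (x - y)" "snd (x - y)"] norm_snd_le[of "snd (x - y)" "fst (x - y)"]
        by (simp_all flip: fst_diff snd_diff)
      have "\<bar>p_power (m + 1) (cl t (snd x)) - p_power (m + 1) (cl t (snd y))\<bar>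
          \<le> m * (B * exp t) powr (m - 1) * \<bar>cl t (snd x) - cl t (snd y)\<bar>"
        by (rule p_power_lipschitz[OF m]) (use mult_pos_pos[OF B0 exp_gt_zero[of t]] in \<open>auto simp: cl_def\<close>)
      also have "\<dots> \<le> m * (B * exp t) powr (m - 1) * norm (x - y)"
        using m le(2) by (intro mult_left_mono) (auto simp: cl_def)
      finally have 1: "\<bar>p_power (m + 1) (cl t (snd x)) - p_power (m + 1) (cl t (snd y))\<bar>
          \<le> m * (B * exp t) powr (m - 1) * norm (x - y)" .
      have 2: "\<bar>fst x - \<bar>snd x\<bar> - (fst y - \<bar>snd y\<bar>)\<bar> \<le> 2 * norm (x - y)"
        using le by linarith
      have "norm (G t x - G t y) \<le> \<bar>p_power (m + 1) (cl t (snd x)) - p_power (m + 1) (cl t (snd y))\<bar>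
          + \<bar>fst x - \<bar>snd x\<bar> - (fst y - \<bar>snd y\<bar>)\<bar>"
        unfolding G_def
        using norm_Pair_le[of "p_power (m + 1) (cl t (snd y)) - p_power (m + 1) (cl t (snd x))"
            "fst x - \<bar>snd x\<bar> - (fst y - \<bar>snd y\<bar>)"]
        by (simp add: abs_minus_commute)
      with 1 2 show ?thesis by (simp add: L_def algebra_simps)
    qed
  qed
  then obtain x where x0: "x 0 = (a, 0)"
    and x: "\<And>t. t \<ge> 0 \<Longrightarrow> (x has_vector_derivative G t (x t)) (at t within {0..})"
    by blast
  define f where "f t = fst (x t)" for t
  define w where "w t = snd (x t)" for t
  have f: "(f has_real_derivative - p_power (m + 1) (cl t (w t))) (at t within {0..})" if "t \<ge> 0" for t
    using bounded_linear.has_vector_derivative[OF bounded_linear_fst x[OF that]]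
    by (simp add: f_def[abs_def] w_def[abs_def] G_def has_real_derivative_iff_has_vector_derivative)
  have w: "(w has_real_derivative f t - \<bar>w t\<bar>) (at t within {0..})" if "t \<ge> 0" for t
    using bounded_linear.has_vector_derivative[OF bounded_linear_snd x[OF that]]
    by (simp add: f_def[abs_def] w_def[abs_def] G_def has_real_derivative_iff_has_vector_derivative)
  have cont: "continuous_on {0..} f" "continuous_on {0..} w"
    by (auto intro!: DERIV_continuous_on f w)
  have init: "f 0 = a" "w 0 = 0" by (auto simp: f_def w_def x0)
  have bound: "\<bar>w t\<bar> < B * exp t" if t: "t \<ge> 0" for t
  proof (rule ccontr)
    assume "\<not> ?thesis"
    then have "\<exists>c. 0 < c \<and> c \<le> t \<and> B * exp c - \<bar>w c\<bar> = 0 \<and> (\<forall>s. 0 \<le> s \<and> s < c \<longrightarrow> 0 < B * exp s - \<bar>w s\<bar>)"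
      using B0 init t
      by (intro first_nonpos_point continuous_intros continuous_on_subset[OF cont(2)]) auto
    then obtain c where c: "0 < c" "\<bar>w c\<bar> = B * exp c" "\<And>s. 0 \<le> s \<Longrightarrow> s < c \<Longrightarrow> \<bar>w s\<bar> < B * exp s"
      by auto
    have "energy m (f c) (w c) \<le> energy m (f 0) (w 0) * exp ((m + 1) * c)"
    proof (rule energy_growth[OF m])
      fix t assume t: "0 < t" "t < c"
      have "cl t (w t) = w t" using c(3)[of t] t by (auto simp: cl_def)
      then show "DERIV f t :> - p_power (m + 1) (w t)"
        using f[of t] t by (simp add: at_within_halfline)
      show "DERIV w t :> f t - \<bar>w t\<bar>"
        using w[of t] t by (simp add: at_within_halfline)
    qed (use c in \<open>auto intro: continuous_on_subset[OF cont(1)] continuous_on_subset[OF cont(2)]\<close>)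
    also have "\<dots> = a\<^sup>2 / 2 * exp ((m + 1) * c)"
      using m by (simp add: init energy_def)
    finally have "(m + 1) * energy m (f c) (w c) \<le> (m + 1) * (a\<^sup>2 / 2 * exp ((m + 1) * c))"
      using m by (intro mult_left_mono) auto
    with abs_powr_le_energy[OF m, of "w c" "f c"]
    have "\<bar>w c\<bar> powr (m + 1) \<le> a\<^sup>2 / 2 * (m + 1) * exp ((m + 1) * c)"
      by (simp add: algebra_simps)
    also have "\<dots> < B powr (m + 1) * exp ((m + 1) * c)"
      by (intro mult_strict_right_mono B) auto
    also have "\<dots> = \<bar>w c\<bar> powr (m + 1)"
      using B0 by (simp add: c(2) powr_mult exp_powr_real mult.commute)
    finally show False by simp
  qed
  have "cl t (w t) = w t" if "t \<ge> 0" for t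
    using bound[OF that] by (auto simp: cl_def)
  with f w init have "trajectory m a f w"
    unfolding trajectory_def by auto
  then show ?thesis by blast
qed

lemma trajectory_bounded:
  assumes m: "1 < m" and "trajectory m a f w" "\<bar>a\<bar> \<le> A" "0 \<le> t" "t \<le> T"
  shows "\<bar>w t\<bar> \<le> ((m + 1) * (A\<^sup>2 / 2 * exp ((m + 1) * T))) powr (1 / (m + 1))"
proof -
  have "energy m (f t) (w t) \<le> energy m (f 0) (w 0) * exp ((m + 1) * t)"
    using assms trajectory_continuous[OF assms(2), of "{0..t}"]
    by (intro energy_growth trajectory_DERIV[OF assms(2)]) auto
  also have "\<dots> = a\<^sup>2 / 2 * exp ((m + 1) * t)"
    using m by (simp add: trajectory_init[OF assms(2)] energy_def)
  also have "\<dots> \<le> A\<^sup>2 / 2 * exp ((m + 1) * T)"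
    using assms by (intro mult_mono divide_right_mono) (auto simp: abs_le_square_iff[symmetric])
  finally have "(m + 1) * energy m (f t) (w t) \<le> (m + 1) * (A\<^sup>2 / 2 * exp ((m + 1) * T))"
    using m by (intro mult_left_mono) auto
  from order_trans[OF abs_powr_le_energy[OF m] this] show ?thesis
    using m by (subst powr_inverse_le_iff) simp_all
qed

text \<open>Gronwall's inequality for the squared distance; \<open>trajectory_bounded\<close> keeps both trajectories in a
strip in which the nonlinearity has a common Lipschitz constant \<open>K\<close>.\<close>
lemma trajectory_dependence:
  assumes m: "1 < m"
  shows "\<exists>C>0. \<forall>a b f w g v t. \<bar>a\<bar> \<le> A \<longrightarrow> \<bar>b\<bar> \<le> A \<longrightarrow> trajectory m a f w \<longrightarrow> trajectory m b g v \<longrightarrow>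
      0 \<le> t \<longrightarrow> t \<le> T \<longrightarrow> (f t - g t)\<^sup>2 + (w t - v t)\<^sup>2 \<le> C * (a - b)\<^sup>2"
proof -
  define M where "M = ((m + 1) * (A\<^sup>2 / 2 * exp ((m + 1) * T))) powr (1 / (m + 1))"
  define K where "K = m * M powr (m - 1)"
  have K0: "0 \<le> K" using m by (simp add: K_def)
  have "(f t - g t)\<^sup>2 + (w t - v t)\<^sup>2 \<le> exp ((K + 3) * T) * (a - b)\<^sup>2"
    if ab: "\<bar>a\<bar> \<le> A" "\<bar>b\<bar> \<le> A" and fw: "trajectory m a f w" and gv: "trajectory m b g v"
      and t: "0 \<le> t" "t \<le> T" for a b f w g v t
  proof -
    define D where "D t = (f t - g t)\<^sup>2 + (w t - v t)\<^sup>2" for t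
    have "exp (- ((K + 3) * t)) * D t \<le> exp (- ((K + 3) * 0)) * D 0"
    proof (rule DERIV_nonpos_imp_decreasing_open[OF t(1)])
      fix s assume s: "0 < s" "s < t"
      define x y P Q where "x = f s - g s" and "y = w s - v s"
        and "P = p_power (m + 1) (w s) - p_power (m + 1) (v s)" and "Q = \<bar>w s\<bar> - \<bar>v s\<bar>"
      have "DERIV D s :> 2 * x * (- P) + 2 * y * (x - Q)"
        unfolding D_def x_def y_def P_def Q_def
        using trajectory_DERIV[OF fw s(1)] trajectory_DERIV[OF gv s(1)]
        by (auto intro!: derivative_eq_intros simp: algebra_simps)
      then have "DERIV (\<lambda>t. exp (- ((K + 3) * t)) * D t) s :>
          exp (- ((K + 3) * s)) * (2 * x * (- P) + 2 * y * (x - Q) - (K + 3) * D s)"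
        by (auto intro!: derivative_eq_intros simp: algebra_simps)
      moreover have "2 * x * (- P) + 2 * y * (x - Q) \<le> (K + 3) * D s"
      proof -
        have P: "\<bar>P\<bar> \<le> K * \<bar>y\<bar>"
          unfolding P_def K_def y_def M_def
          by (intro p_power_lipschitz m trajectory_bounded[OF m fw] trajectory_bounded[OF m gv])
            (use s t ab in auto)
        have Q: "\<bar>Q\<bar> \<le> \<bar>y\<bar>" by (simp add: Q_def y_def)
        have xy: "2 * (\<bar>x\<bar> * \<bar>y\<bar>) \<le> x\<^sup>2 + y\<^sup>2"
          using sum_squares_bound[of "\<bar>x\<bar>" "\<bar>y\<bar>"] by (simp add: mult.assoc)
        have "x * (- P) \<le> \<bar>x\<bar> * (K * \<bar>y\<bar>)"
          using P by (metis abs_ge_self abs_minus_cancel abs_mult abs_ge_zero mult_left_mono order_trans)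
        moreover have "y * (x - Q) \<le> \<bar>x\<bar> * \<bar>y\<bar> + y\<^sup>2"
        proof -
          have "y * (x - Q) \<le> \<bar>y\<bar> * \<bar>x - Q\<bar>" by (metis abs_ge_self abs_mult)
          also have "\<dots> \<le> \<bar>y\<bar> * (\<bar>x\<bar> + \<bar>y\<bar>)" using Q by (intro mult_left_mono) auto
          finally show ?thesis by (simp add: algebra_simps power2_eq_square)
        qed
        moreover have "K * (2 * (\<bar>x\<bar> * \<bar>y\<bar>)) \<le> K * (x\<^sup>2 + y\<^sup>2)"
          by (intro mult_left_mono xy K0)
        moreover have "D s = x\<^sup>2 + y\<^sup>2" by (simp add: D_def x_def y_def)
        moreover have "2 * (\<bar>x\<bar> * \<bar>y\<bar>) \<le> 3 * x\<^sup>2 + y\<^sup>2"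
          using xy zero_le_power2[of x] by linarith
        ultimately show ?thesis by (simp add: algebra_simps)
      qed
      then have "exp (- ((K + 3) * s)) * (2 * x * (- P) + 2 * y * (x - Q) - (K + 3) * D s) \<le> 0"
        by (intro mult_nonneg_nonpos) auto
      ultimately show "\<exists>y. DERIV (\<lambda>t. exp (- ((K + 3) * t)) * D t) s :> y \<and> y \<le> 0" by blast
    qed (unfold D_def, intro continuous_intros trajectory_continuous[OF fw] trajectory_continuous[OF gv]; auto)
    from exp_minus_mult_leD[OF this] have "D t \<le> exp ((K + 3) * t) * D 0"
      by (simp add: mult.commute)
    also have "\<dots> \<le> exp ((K + 3) * T) * D 0"
      using t K0 by (intro mult_right_mono) (auto simp: D_def intro!: mult_left_mono)
    finally show ?thesis
      by (simp add: D_def trajectory_init[OF fw] trajectory_init[OF gv])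
  qed
  then show ?thesis by (intro exI[of _ "exp ((K + 3) * T)"]) auto
qed

lemma trajectory_unique:
  assumes "1 < m" "trajectory m a f w" "trajectory m a g v" "0 \<le> t"
  shows "f t = g t" "w t = v t"
proof -
  obtain C where "\<forall>a' b f w g v s. \<bar>a'\<bar> \<le> \<bar>a\<bar> \<longrightarrow> \<bar>b\<bar> \<le> \<bar>a\<bar> \<longrightarrow> trajectory m a' f w \<longrightarrow> trajectory m b g v \<longrightarrow>
      0 \<le> s \<longrightarrow> s \<le> t \<longrightarrow> (f s - g s)\<^sup>2 + (w s - v s)\<^sup>2 \<le> C * (a' - b)\<^sup>2"
    using trajectory_dependence[OF assms(1), of "\<bar>a\<bar>" t] by blast
  then have "(f t - g t)\<^sup>2 + (w t - v t)\<^sup>2 \<le> C * (a - a)\<^sup>2"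
    using assms by blast
  then have "(f t - g t)\<^sup>2 + (w t - v t)\<^sup>2 \<le> 0" by simp
  then show "f t = g t" "w t = v t"
    by (simp_all add: sum_power2_le_zero_iff)
qed

lemma trajectory_close:
  assumes m: "1 < m" and fw: "trajectory m a f w" and "0 < e"
  shows "\<exists>d>0. \<forall>b g v t. \<bar>b - a\<bar> < d \<longrightarrow> trajectory m b g v \<longrightarrow> 0 \<le> t \<longrightarrow> t \<le> T \<longrightarrow>
      \<bar>g t - f t\<bar> < e \<and> \<bar>v t - w t\<bar> < e"
proof -
  obtain C where "C > 0" and C: "\<And>a' b f w g v t. \<bar>a'\<bar> \<le> \<bar>a\<bar> + 1 \<Longrightarrow> \<bar>b\<bar> \<le> \<bar>a\<bar> + 1 \<Longrightarrow> trajectory m a' f w \<Longrightarrow>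
      trajectory m b g v \<Longrightarrow> 0 \<le> t \<Longrightarrow> t \<le> T \<Longrightarrow> (f t - g t)\<^sup>2 + (w t - v t)\<^sup>2 \<le> C * (a' - b)\<^sup>2"
    using trajectory_dependence[OF m, of "\<bar>a\<bar> + 1" T] by blast
  define d where "d = min 1 (e / sqrt C)"
  have "\<bar>g t - f t\<bar> < e \<and> \<bar>v t - w t\<bar> < e"
    if b: "\<bar>b - a\<bar> < d" and gv: "trajectory m b g v" and t: "0 \<le> t" "t \<le> T" for b g v t
  proof -
    have "(f t - g t)\<^sup>2 + (w t - v t)\<^sup>2 \<le> C * (a - b)\<^sup>2"
      by (rule C) (use b fw gv t in \<open>auto simp: d_def\<close>)
    also have "\<dots> = (sqrt C * \<bar>b - a\<bar>)\<^sup>2"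
      using \<open>C > 0\<close> by (simp add: power_mult_distrib power2_commute)
    also have "\<dots> < e\<^sup>2"
    proof (rule power_strict_mono)
      have "\<bar>b - a\<bar> < e / sqrt C" using b by (simp add: d_def)
      then show "sqrt C * \<bar>b - a\<bar> < e" using \<open>C > 0\<close> by (simp add: field_simps)
    qed (use \<open>C > 0\<close> in auto)
    finally have "(f t - g t)\<^sup>2 + (w t - v t)\<^sup>2 < e\<^sup>2" .
    then have "(g t - f t)\<^sup>2 < e\<^sup>2" "(v t - w t)\<^sup>2 < e\<^sup>2"
      using zero_le_power2[of "f t - g t"] zero_le_power2[of "w t - v t"]
      unfolding power2_commute[of "g t"] power2_commute[of "v t"] by linarith+
    then show ?thesis
      using \<open>0 < e\<close> power2_less_imp_less[of "\<bar>g t - f t\<bar>" e] power2_less_imp_less[of "\<bar>v t - w t\<bar>" e]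
      by simp
  qed
  moreover have "d > 0" using \<open>C > 0\<close> \<open>0 < e\<close> by (simp add: d_def)
  ultimately show ?thesis by blast
qed

section \<open>Equivalence with the initial value problem\<close>

lemma ivp_solution_imp_trajectory:
  assumes p: "1 < p" "p < 2" and f: "ivp_solution p a f"
  shows "trajectory (1 / (p - 1)) a f (\<lambda>r. - p_power p (hderiv f r))"
proof -
  define P where "P r = p_power p (hderiv f r)" for r
  have C: "C1_halfline f" "C1_halfline P" 
    and eq: "\<And>r. r > 0 \<Longrightarrow> hderiv P r + f r - \<bar>hderiv f r\<bar> powr (p - 1) = 0"
    and init: "f 0 = a" "hderiv f 0 = 0"
    using f unfolding ivp_solution_def P_def[abs_def, symmetric] by auto
  have der: "(h has_real_derivative hderiv h r) (at r within {0..})" if "C1_halfline h" "r \<ge> 0" for h r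
    using that unfolding C1_halfline_def hderiv_def
    by (auto simp: differentiable_on_def vector_derivative_works has_real_derivative_iff_has_vector_derivative)
  have abs: "\<bar>P r\<bar> = \<bar>hderiv f r\<bar> powr (p - 1)" for r
    by (cases "hderiv f r = 0") (simp_all add: P_def abs_p_power)
  have cont: "continuous_on {0..} P" "continuous_on {0..} f" "continuous_on {0..} (hderiv P)"
    using C der by (auto intro!: DERIV_continuous_on simp: C1_halfline_def)
  \<comment> \<open>The equation is given for \<open>r > 0\<close> only; it extends to \<open>r = 0\<close> by continuity.\<close>
  have "continuous_on (closure {0<..}) (\<lambda>r. hderiv P r + f r - \<bar>P r\<bar>)"
    by (auto intro!: continuous_intros cont)
  then have "hderiv P r + f r - \<bar>P r\<bar> = 0" if "r \<ge> 0" for r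
    by (rule continuous_constant_on_closure) (use eq abs that in auto)
  then have "hderiv P r = \<bar>P r\<bar> - f r" if "r \<ge> 0" for r
    using that by force
  then have "((\<lambda>r. - P r) has_real_derivative f r - \<bar>- P r\<bar>) (at r within {0..})" if "r \<ge> 0" for r
    using that der[OF C(2) that] by (auto intro!: derivative_eq_intros)
  moreover have "(f has_real_derivative - p_power (1 / (p - 1) + 1) (- P r)) (at r within {0..})" if "r \<ge> 0" for r
    using der[OF C(1) that] p by (simp add: P_def p_power_inverse)
  ultimately show ?thesis
    unfolding trajectory_def P_def[symmetric] using init by (auto simp: P_def)
qed

lemma at_within_halfline_neq_bot:
  assumes "0 \<le> r"
  shows "at r within {0..} \<noteq> (bot :: real filter)"
proof (cases "r = 0")
  case True
  then show ?thesis by (simp add: at_within_Ici_at_right)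
qed (use assms in \<open>simp add: at_within_halfline\<close>)

lemma trajectory_hderiv:
  assumes "trajectory m a f w" "0 \<le> r"
  shows "hderiv f r = - p_power (m + 1) (w r)"
  unfolding hderiv_def using assms
  by (intro vector_derivative_within at_within_halfline_neq_bot)
    (auto simp: trajectory_def has_real_derivative_iff_has_vector_derivative)

lemma trajectory_imp_ivp_solution:
  assumes p: "1 < p" "p < 2" and fw: "trajectory (1 / (p - 1)) a f w"
  shows "ivp_solution p a f"
proof -
  define m where "m = 1 / (p - 1)"
  have fw: "trajectory m a f w" using fw by (simp add: m_def)
  have h: "hderiv f r = - p_power (m + 1) (w r)" if "r \<ge> 0" for r
    by (rule trajectory_hderiv[OF fw that])
  have P: "p_power p (hderiv f r) = - w r" if "r \<ge> 0" for r
    using p by (simp add: h[OF that] p_power_inverse m_def)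
  have m: "1 < m" using p by (simp add: m_def)
  have f: "C1_halfline f"
    unfolding C1_halfline_def
  proof
    show "f differentiable_on {0..}"
      using fw by (auto simp: trajectory_def differentiable_on_def intro!: differentiableI_vector
          simp: has_real_derivative_iff_has_vector_derivative)
    have "continuous_on {0..} (\<lambda>r. - p_power (m + 1) (w r))"
      by (intro continuous_intros m trajectory_continuous(2)[OF fw]) auto
    then show "continuous_on {0..} (hderiv f)"
      by (rule continuous_on_eq) (simp add: h)
  qed
  have derP: "((\<lambda>s. p_power p (hderiv f s)) has_vector_derivative \<bar>w r\<bar> - f r) (at r within {0..})"
    if r: "r \<ge> 0" for r
  proof (rule has_vector_derivative_transform)
    have "((\<lambda>s. - w s) has_real_derivative \<bar>w r\<bar> - f r) (at r within {0..})"
      using fw r by (auto simp: trajectory_def intro!: derivative_eq_intros)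
    then show "((\<lambda>s. - w s) has_vector_derivative \<bar>w r\<bar> - f r) (at r within {0..})"
      by (simp add: has_real_derivative_iff_has_vector_derivative)
  qed (use r P in auto)
  have hP: "hderiv (\<lambda>s. p_power p (hderiv f s)) r = \<bar>w r\<bar> - f r" if "r \<ge> 0" for r
    unfolding hderiv_def[of "\<lambda>s. p_power p (hderiv f s)"]
    using that by (intro vector_derivative_within at_within_halfline_neq_bot derP) auto
  have "C1_halfline (\<lambda>s. p_power p (hderiv f s))"
    unfolding C1_halfline_def
  proof
    show "(\<lambda>s. p_power p (hderiv f s)) differentiable_on {0..}"
      using derP by (auto simp: differentiable_on_def intro: differentiableI_vector)
    have "continuous_on {0..} (\<lambda>r. \<bar>w r\<bar> - f r)"
      by (intro continuous_intros trajectory_continuous[OF fw]) auto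
    then show "continuous_on {0..} (hderiv (\<lambda>s. p_power p (hderiv f s)))"
      by (rule continuous_on_eq) (simp add: hP)
  qed
  moreover have "\<bar>hderiv f r\<bar> powr (p - 1) = \<bar>w r\<bar>" if "r \<ge> 0" for r
  proof (cases "hderiv f r = 0")
    case True
    then show ?thesis using P[OF that] by simp
  next
    case False
    then show ?thesis using abs_p_power[OF False, of p] P[OF that] by simp
  qed
  ultimately show ?thesis
    unfolding ivp_solution_def using f hP h[of 0] trajectory_init[OF fw] by auto
qed

section \<open>Positivity and the trap\<close>

text \<open>For \<open>w \<le> 0\<close> the equation reads \<open>w' = f + w\<close>, so \<open>exp (- t) * w\<close> has the positive derivative
\<open>exp (- t) * f\<close> there and the barrier principle applies.\<close>
lemma trajectory_w_pos_aux:
  assumes fw: "trajectory m a f w"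
    and pos: "\<forall>t\<in>{0..<T}. 0 < f t" and t: "0 < t" "t < T"
  shows "0 < w t"
proof -
  have "0 < exp (- t) * w t"
  proof (rule positive_by_barrier[where u = "\<lambda>t. exp (- t) * w t" and s = 0 and T = t])
    fix s assume s: "0 < s" "s \<le> t" "exp (- s) * w s \<le> 0"
    then have "w s \<le> 0" by (simp add: mult_le_0_iff)
    then have "DERIV (\<lambda>s. exp (- s) * w s) s :> exp (- s) * f s"
      using trajectory_DERIV(2)[OF fw s(1)] by (auto intro!: derivative_eq_intros simp: algebra_simps)
    moreover have "0 < exp (- s) * f s" using pos s t by simp
    ultimately show "\<exists>d>0. DERIV (\<lambda>s. exp (- s) * w s) s :> d" by blast
  qed (use t in \<open>auto intro!: continuous_intros trajectory_continuous[OF fw] simp: trajectory_init[OF fw]\<close>)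
  then show ?thesis by (simp add: zero_less_mult_iff)
qed

text \<open>Positivity of \<open>w\<close> persists up to and including the first zero of \<open>f\<close>, because \<open>exp t * w\<close> is
nondecreasing before it. Therefore \<open>f\<close> crosses zero there with negative slope.\<close>
lemma trajectory_w_pos:
  assumes fw: "trajectory m a f w"
    and pos: "\<forall>t\<in>{0..<T}. 0 < f t" and t: "0 < t" "t \<le> T"
  shows "0 < w t"
proof -
  have half: "0 < w (t / 2)"
    by (rule trajectory_w_pos_aux[OF fw pos]) (use t in auto)
  have "exp (t / 2) * w (t / 2) \<le> exp t * w t"
  proof (rule nondecreasing_if_DERIV_nonneg[where u = "\<lambda>t. exp t * w t" and s = "t / 2"])
    fix x assume x: "t / 2 < x" "x < t"
    have "0 < w x" by (rule trajectory_w_pos_aux[OF fw pos]) (use t x in auto)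
    then show "DERIV (\<lambda>t. exp t * w t) x :> exp x * f x"
      using trajectory_DERIV(2)[OF fw, of x] x t by (auto intro!: derivative_eq_intros simp: algebra_simps)
    have "0 < f x" using pos x t by auto
    then show "0 \<le> exp x * f x" by simp
  qed (use t in \<open>auto intro!: continuous_intros trajectory_continuous[OF fw]\<close>)
  moreover have "0 < exp (t / 2) * w (t / 2)" using half by simp
  ultimately have "0 < exp t * w t" by linarith
  then show ?thesis by (simp add: zero_less_mult_iff)
qed

lemma trajectory_DERIV_pos:
  assumes fw: "trajectory m a f w"
    and pos: "\<forall>t\<in>{0..<T}. 0 < f t" and t: "0 < t" "t \<le> T"
  shows "DERIV f t :> - (w t powr m)" "DERIV w t :> f t - w t"
  using trajectory_DERIV[OF fw t(1)] trajectory_w_pos[OF fw pos t] by (simp_all add: p_power_pos)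

text \<open>The level at which \<open>w powr (m - 1) = 1 / 8\<close>. Any value below \<open>1 / 4\<close> would serve to make the line
\<open>w = 2 * f\<close> impenetrable from below.\<close>
definition trap_level :: "real \<Rightarrow> real" where
  "trap_level m = (1 / 8) powr (1 / (m - 1))"

text \<open>All inequalities are strict, so that being trapped is an open condition on the initial value. The time \<open>s = 0\<close>
is admitted, where small initial values are trapped at once since \<open>w 0 = 0\<close>.\<close>
definition trapped_at :: "real \<Rightarrow> (real \<Rightarrow> real) \<Rightarrow> (real \<Rightarrow> real) \<Rightarrow> real \<Rightarrow> bool" where
  "trapped_at m f w s \<longleftrightarrow> 0 \<le> s \<and> (\<forall>t. 0 \<le> t \<and> t \<le> s \<longrightarrow> 0 < f t) \<and>
     f s < trap_level m \<and> w s < trap_level m \<and> w s < 2 * f s"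

lemma trap_level_pos: "0 < trap_level m"
  by (simp add: trap_level_def)

lemma powr_below_trap_level:
  assumes "1 < m" "0 \<le> z" "z \<le> trap_level m"
  shows "z powr (m - 1) \<le> 1 / 8"
  using assms powr_inverse_le_iff[of "m - 1" z "1 / 8"] by (simp add: trap_level_def)

lemma powr_split: "0 \<le> z \<Longrightarrow> z powr m = z powr (m - 1) * z" for z m :: real
  by (cases "z = 0") (auto simp: powr_diff)

text \<open>Below the trap level, on or above the line \<open>w = 2 * f\<close>, the derivative of \<open>2 * f - w\<close> is at least
\<open>w * (1 / 2 - 2 * w powr (m - 1))\<close>, which is positive. The bound on \<open>w\<close> persists because
\<open>w' = f - w\<close> and \<open>f\<close> decreases.\<close>
lemma trapped_barrier:
  assumes m: "1 < m" and fw: "trajectory m a f w" and trap: "trapped_at m f w s"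
    and pos: "\<forall>t\<in>{0..<T}. 0 < f t" and t: "s \<le> t" "t \<le> T"
  shows "w t < 2 * f t"
proof (cases "s < t")
  case False
  then show ?thesis using t trap by (auto simp: trapped_at_def)
next
  case True
  have s: "0 \<le> s" using trap by (simp add: trapped_at_def)
  note w_pos = trajectory_w_pos[OF fw pos]
  note der = trajectory_DERIV_pos[OF fw pos]
  note cont = trajectory_continuous[OF fw]
  have "0 < 2 * f t - w t"
  proof (rule positive_by_barrier[where u = "\<lambda>t. 2 * f t - w t", OF _ _ _ True t(2)])
    show "continuous_on {s..T} (\<lambda>t. 2 * f t - w t)"
      using s by (intro continuous_intros cont) auto
    show "0 \<le> 2 * f s - w s" using trap by (simp add: trapped_at_def)
    fix x assume x: "s < x" "x \<le> T" "2 * f x - w x \<le> 0"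
    have "exp s * (trap_level m - w s) \<le> exp x * (trap_level m - w x)"
    proof (rule nondecreasing_if_DERIV_nonneg[where u = "\<lambda>t. exp t * (trap_level m - w t)"])
      fix y assume y: "s < y" "y < x"
      show "DERIV (\<lambda>t. exp t * (trap_level m - w t)) y :> exp y * (trap_level m - f y)"
        using der(2)[of y] y x s by (auto intro!: derivative_eq_intros simp: algebra_simps)
      have "f y \<le> f s"
        by (rule nonincreasing_if_DERIV_nonpos[where u' = "\<lambda>t. - (w t powr m)"])
          (use x y s in \<open>auto intro!: der cont\<close>)
      then show "0 \<le> exp y * (trap_level m - f y)"
        using trap by (simp add: trapped_at_def)
    qed (use x s in \<open>auto intro!: continuous_intros cont\<close>)
    moreover have "0 < exp s * (trap_level m - w s)" using trap by (simp add: trapped_at_def)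
    ultimately have "0 < exp x * (trap_level m - w x)" by linarith
    then have wx: "w x < trap_level m" by (simp add: zero_less_mult_iff)
    have "0 < w x" using x s by (intro w_pos) auto
    then have "w x powr m \<le> 1 / 8 * w x"
      using powr_below_trap_level[OF m, of "w x"] wx by (subst powr_split) (auto intro: mult_right_mono)
    with x(3) \<open>0 < w x\<close> have "0 < 2 * (- (w x powr m)) - (f x - w x)" by simp
    moreover have "DERIV (\<lambda>t. 2 * f t - w t) x :> 2 * (- (w x powr m)) - (f x - w x)"
      using x s by (auto intro!: derivative_eq_intros der)
    ultimately show "\<exists>d>0. DERIV (\<lambda>t. 2 * f t - w t) x :> d" by blast
  qed
  then show ?thesis by simp
qed

text \<open>At a first zero of \<open>f\<close> the barrier would still give \<open>w < 2 * f = 0\<close>, contradicting \<open>w > 0\<close>.\<close>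
lemma trapped_forever:
  assumes m: "1 < m" and fw: "trajectory m a f w" and trap: "trapped_at m f w s"
  shows "0 \<le> t \<Longrightarrow> 0 < f t" "s \<le> t \<Longrightarrow> w t < 2 * f t"
proof -
  have s: "0 \<le> s" "\<And>t. 0 \<le> t \<Longrightarrow> t \<le> s \<Longrightarrow> 0 < f t" using trap by (auto simp: trapped_at_def)
  have pos: "0 < f t" if "0 \<le> t" for t
  proof (rule ccontr)
    assume neg: "\<not> 0 < f t"
    then have "s \<le> t" using s(2)[of t] that by linarith
    then have "\<exists>c. s < c \<and> c \<le> t \<and> f c = 0 \<and> (\<forall>t. s \<le> t \<and> t < c \<longrightarrow> 0 < f t)"
      using s neg by (intro first_nonpos_point trajectory_continuous[OF fw]) auto
    then obtain c where c: "s < c" "f c = 0" "\<And>t. s \<le> t \<Longrightarrow> t < c \<Longrightarrow> 0 < f t" by auto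
    have p: "\<forall>t\<in>{0..<c}. 0 < f t"
      using s(2) c(3) by (metis atLeastLessThan_iff linorder_linear)
    have "w c < 2 * f c" using c by (intro trapped_barrier[OF m fw trap p]) auto
    moreover have "0 < w c" using c s by (intro trajectory_w_pos[OF fw p]) auto
    ultimately show False using c by simp
  qed
  show "0 \<le> t \<Longrightarrow> 0 < f t" by (rule pos)
  show "s \<le> t \<Longrightarrow> w t < 2 * f t"
    by (rule trapped_barrier[OF m fw trap, where T = t]) (auto intro: pos)
qed

section \<open>Trajectories that stay positive\<close>

context
  fixes m a :: real and f w :: "real \<Rightarrow> real"
  assumes m: "1 < m" and fw: "trajectory m a f w" and pos_all: "\<forall>t\<ge>0. 0 < f t"
begin

lemma positive_f: "0 \<le> t \<Longrightarrow> 0 < f t"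
  using pos_all by simp

lemma positive_w: "0 < t \<Longrightarrow> 0 < w t"
  by (rule trajectory_w_pos[OF fw, where T = t]) (auto intro: positive_f)

lemma positive_DERIV:
  assumes "0 < t"
  shows "DERIV f t :> - (w t powr m)" "DERIV w t :> f t - w t"
  by (rule trajectory_DERIV_pos[OF fw, where T = t]; use assms in \<open>auto intro: positive_f\<close>)+

lemma positive_DERIV_powr:
  assumes "0 < t"
  shows "DERIV (\<lambda>t. w t powr b) t :> b * w t powr (b - 1) * (f t - w t)"
  using positive_DERIV(2)[OF assms] positive_w[OF assms]
  by (auto intro!: derivative_eq_intros simp: powr_diff)

lemma positive_f_decreasing:
  assumes "0 \<le> s" "s < t"
  shows "f t < f s"
proof -
  have "\<exists>l z. s < z \<and> z < t \<and> DERIV f z :> l \<and> f t - f s = (t - s) * l"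
    using assms
    by (intro MVT trajectory_continuous[OF fw])
      (auto simp: real_differentiable_def intro!: exI positive_DERIV(1))
  then obtain l z where z: "s < z" "z < t" "DERIV f z :> l" "f t - f s = (t - s) * l" by blast
  have "l = - (w z powr m)"
    using z assms by (intro DERIV_unique[OF z(3) positive_DERIV(1)]) auto
  then have "l < 0" using positive_w[of z] z assms by simp
  then have "(t - s) * l < 0" using assms by (simp add: mult_pos_neg)
  then show ?thesis using z by simp
qed

text \<open>Otherwise \<open>f' \<le> - \<eta> powr m\<close> from time \<open>s\<close> on, and \<open>f\<close> would reach zero.\<close>
lemma positive_w_small:
  assumes "0 < \<eta>" "0 < s"
  shows "\<exists>t\<ge>s. w t < \<eta>"
proof (rule ccontr)
  assume "\<not> ?thesis"
  then have ge: "\<eta> \<le> w t" if "s \<le> t" for t using that by force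
  define t where "t = s + f s / \<eta> powr m"
  have t: "s \<le> t" using positive_f[of s] assms by (simp add: t_def)
  have "f t + \<eta> powr m * t \<le> f s + \<eta> powr m * s"
  proof (rule nonincreasing_if_DERIV_nonpos[where u = "\<lambda>t. f t + \<eta> powr m * t", OF t])
    fix x assume x: "s < x" "x < t"
    show "DERIV (\<lambda>t. f t + \<eta> powr m * t) x :> - (w x powr m) + \<eta> powr m"
      using x assms by (auto intro!: derivative_eq_intros positive_DERIV)
    show "- (w x powr m) + \<eta> powr m \<le> 0"
      using ge[of x] x assms m by (auto intro: powr_mono2)
  qed (use assms in \<open>auto intro!: continuous_intros trajectory_continuous[OF fw]\<close>)
  moreover have "\<eta> powr m * t = \<eta> powr m * s + f s"
    using assms by (simp add: t_def distrib_left)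
  ultimately have "f t \<le> 0" by simp
  then show False using positive_f[of t] t assms by simp
qed

text \<open>Below the diagonal \<open>w\<close> increases, which is incompatible with \<open>w\<close> becoming small. Once
above it, the trajectory stays there, since \<open>exp t * (w - f)\<close> has derivative \<open>exp t * w powr m\<close>.\<close>
lemma positive_crosses_diagonal: "\<exists>s\<ge>1. \<forall>t\<ge>s. f t \<le> w t"
proof -
  obtain s where s: "1 \<le> s" "f s \<le> w s"
  proof (atomize_elim, rule ccontr)
    assume "\<not> (\<exists>s\<ge>1. f s \<le> w s)"
    then have lt: "w x < f x" if "1 \<le> x" for x using that by force
    obtain t where t: "t \<ge> 1" "w t < w 1"
      using positive_w_small[of "w 1" 1] positive_w[of 1] by auto
    have "w 1 \<le> w t"
    proof (rule nondecreasing_if_DERIV_nonneg[OF t(1)])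
      fix x assume x: "1 < x" "x < t"
      then show "DERIV w x :> f x - w x" by (intro positive_DERIV) auto
      show "0 \<le> f x - w x" using lt[of x] x by simp
    qed (auto intro!: trajectory_continuous[OF fw])
    then show False using t by simp
  qed
  have "f t \<le> w t" if t: "s \<le> t" for t
  proof -
    have "exp s * (w s - f s) \<le> exp t * (w t - f t)"
    proof (rule nondecreasing_if_DERIV_nonneg[where u = "\<lambda>t. exp t * (w t - f t)", OF t])
      fix x assume x: "s < x" "x < t"
      show "DERIV (\<lambda>t. exp t * (w t - f t)) x :> exp x * w x powr m"
        using x s positive_DERIV[of x] by (auto intro!: derivative_eq_intros simp: algebra_simps)
    qed (use s in \<open>auto intro!: continuous_intros trajectory_continuous[OF fw]\<close>)
    moreover have "0 \<le> exp s * (w s - f s)" using s by simp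
    ultimately have "0 \<le> exp t * (w t - f t)" by linarith
    then show ?thesis by (simp add: zero_le_mult_iff)
  qed
  then show ?thesis using s by blast
qed

lemma positive_tendsto_zero: "(w \<longlongrightarrow> 0) at_top" "(f \<longlongrightarrow> 0) at_top"
proof -
  obtain s where s: "1 \<le> s" "\<And>t. s \<le> t \<Longrightarrow> f t \<le> w t"
    using positive_crosses_diagonal by blast
  have dec: "w t \<le> w r" if "s \<le> r" "r \<le> t" for r t
    by (rule nonincreasing_if_DERIV_nonpos[where u' = "\<lambda>t. f t - w t"])
      (use s that in \<open>auto intro!: positive_DERIV trajectory_continuous[OF fw]\<close>)
  show w: "(w \<longlongrightarrow> 0) at_top"
  proof (rule order_tendstoI)
    fix y :: real assume "y < 0"
    show "\<forall>\<^sub>F t in at_top. y < w t"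
      using eventually_gt_at_top[of 0]
      by eventually_elim (use positive_w \<open>y < 0\<close> in \<open>auto intro: less_trans\<close>)
  next
    fix y :: real assume "0 < y"
    then obtain r where r: "r \<ge> s" "w r < y" using positive_w_small[of y s] s by auto
    show "\<forall>\<^sub>F t in at_top. w t < y"
      using eventually_ge_at_top[of r]
      by eventually_elim (use dec r in \<open>auto intro: le_less_trans\<close>)
  qed
  show "(f \<longlongrightarrow> 0) at_top"
  proof (rule tendsto_sandwich[OF _ _ tendsto_const w])
    show "\<forall>\<^sub>F t in at_top. 0 \<le> f t"
      using eventually_ge_at_top[of 0] by eventually_elim (auto intro: less_imp_le positive_f)
    show "\<forall>\<^sub>F t in at_top. f t \<le> w t"
      using eventually_ge_at_top[of s] by eventually_elim (auto intro: s)
  qed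
qed

lemma positive_w_powr_tendsto_zero:
  assumes "0 < b"
  shows "((\<lambda>t. w t powr b) \<longlongrightarrow> 0) at_top"
proof -
  have "\<forall>\<^sub>F t in at_top. 0 \<le> w t"
    using eventually_gt_at_top[of 0] by eventually_elim (auto intro: less_imp_le positive_w)
  then have "((\<lambda>t. w t powr b) \<longlongrightarrow> 0 powr b) at_top"
    using assms by (intro tendsto_powr2 positive_tendsto_zero tendsto_const) auto
  then show ?thesis by simp
qed

text \<open>The curve \<open>w powr m = m * f\<close> approximates the strong stable manifold of the origin from above: the
function \<open>m * f - w powr m\<close> decreases along the trajectory and tends to \<open>0\<close>.\<close>
lemma positive_w_powr_le:
  assumes "0 < t"
  shows "w t powr m \<le> m * f t"
proof -
  have "0 \<le> m * f t - w t powr m"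
  proof (rule limit_le_if_DERIV_nonpos[where u = "\<lambda>t. m * f t - w t powr m"])
    have "((\<lambda>t. m * f t - w t powr m) \<longlongrightarrow> m * 0 - 0) at_top"
      using m by (intro tendsto_intros positive_tendsto_zero positive_w_powr_tendsto_zero) auto
    then show "((\<lambda>t. m * f t - w t powr m) \<longlongrightarrow> 0) at_top" by simp
    fix x assume x: "t \<le> x"
    have "DERIV (\<lambda>t. m * f t - w t powr m) x :> m * (- (w x powr m)) - m * w x powr (m - 1) * (f x - w x)"
      using x assms by (intro DERIV_diff DERIV_cmult positive_DERIV positive_DERIV_powr) auto
    then show "DERIV (\<lambda>t. m * f t - w t powr m) x :> - (m * w x powr (m - 1) * f x)"
      using positive_w[of x] x assms by (simp add: powr_split[of "w x" m] algebra_simps)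
    show "- (m * w x powr (m - 1) * f x) \<le> 0"
      using positive_f[of x] x assms m by simp
  qed
  then show ?thesis by simp
qed

text \<open>Two applications of L'Hospital's rule: the first gives \<open>w / f \<rightarrow> 1\<close> from the quotient of
\<open>exp t * w\<close> and \<open>exp t * f\<close>, the second gives \<open>f powr (1 - m) / t \<rightarrow> m - 1\<close>, because
\<open>f powr (1 - m)\<close> has derivative \<open>(m - 1) * (w / f) powr m\<close>.\<close>
lemma positive_slow_decay:
  assumes slow: "\<forall>t\<ge>s. w t < 2 * f t"
  shows "((\<lambda>t. t powr (1 / (m - 1)) * f t) \<longlongrightarrow> (1 / (m - 1)) powr (1 / (m - 1))) at_top"
proof -
  define s0 where "s0 = max 1 s"
  have ev: "\<forall>\<^sub>F t in at_top. s0 \<le> t" by (rule eventually_ge_at_top)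
  have s0: "0 < t" "s \<le> t" "0 < f t" "0 < w t" "w t < 2 * f t" if "s0 \<le> t" for t
    using that slow[rule_format, of t] positive_f[of t] positive_w[of t] by (auto simp: s0_def)
  have q: "((\<lambda>t. w t powr m / f t) \<longlongrightarrow> 0) at_top"
  proof (rule tendsto_sandwich[OF _ _ tendsto_const])
    show "\<forall>\<^sub>F t in at_top. 0 \<le> w t powr m / f t"
      using ev by eventually_elim (intro divide_nonneg_pos powr_ge_zero s0(3))
    show "\<forall>\<^sub>F t in at_top. w t powr m / f t \<le> 2 * w t powr (m - 1)"
      using ev
    proof eventually_elim
      case (elim t)
      have "w t powr m \<le> w t powr (m - 1) * (2 * f t)"
        using s0[OF elim] by (subst powr_split) (auto intro!: mult_left_mono)
      then show ?case using s0[OF elim] by (simp add: field_simps)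
    qed
    show "((\<lambda>t. 2 * w t powr (m - 1)) \<longlongrightarrow> 0) at_top"
      using tendsto_mult[OF tendsto_const positive_w_powr_tendsto_zero[of "m - 1"], of 2] m by simp
  qed
  have ev_half: "\<forall>\<^sub>F t in at_top. w t powr m \<le> f t / 2"
  proof -
    have "\<forall>\<^sub>F t in at_top. w t powr m / f t < 1 / 2"
      by (rule order_tendstoD(2)[OF q]) simp
    then show ?thesis
      using ev by eventually_elim (use s0(3) in \<open>simp add: divide_less_eq\<close>)
  qed
  have fe: "filterlim (\<lambda>t. exp t * f t) at_top at_top"
  proof -
    obtain s1 where s1: "s0 \<le> s1" "\<And>t. s1 \<le> t \<Longrightarrow> w t powr m \<le> f t / 2"
      using eventually_conj[OF ev ev_half] by (auto simp: eventually_at_top_linorder)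
    have ge: "exp (s1 / 2) * f s1 * exp (t / 2) \<le> exp t * f t" if t: "s1 \<le> t" for t
    proof -
      have "exp (s1 / 2) * f s1 \<le> exp (t / 2) * f t"
      proof (rule nondecreasing_if_DERIV_nonneg[where u = "\<lambda>t. exp (t / 2) * f t", OF t])
        fix x assume x: "s1 < x" "x < t"
        show "DERIV (\<lambda>t. exp (t / 2) * f t) x :> exp (x / 2) * (f x / 2 - w x powr m)"
          using positive_DERIV(1)[of x] s0(1)[of x] x s1(1)
          by (auto intro!: derivative_eq_intros simp: algebra_simps)
        show "0 \<le> exp (x / 2) * (f x / 2 - w x powr m)" using s1(2)[of x] x by simp
      qed (use s0(1)[of s1] s1(1) in \<open>auto intro!: continuous_intros trajectory_continuous[OF fw]\<close>)
      then have "exp (s1 / 2) * f s1 * exp (t / 2) \<le> exp (t / 2) * f t * exp (t / 2)"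
        by (rule mult_right_mono) simp
      also have "\<dots> = (exp (t / 2) * exp (t / 2)) * f t" by (simp only: mult_ac)
      also have "\<dots> = exp t * f t" by (simp flip: exp_add)
      finally show ?thesis .
    qed
    have "filterlim (\<lambda>t::real. t * (1 / 2)) at_top at_top"
      by (intro filterlim_at_top_mult_tendsto_pos[OF tendsto_const] filterlim_ident) auto
    then have "filterlim (\<lambda>t::real. exp (t / 2)) at_top at_top"
      by (intro filterlim_compose[OF exp_at_top]) simp
    then have "filterlim (\<lambda>t. exp (s1 / 2) * f s1 * exp (t / 2)) at_top at_top"
      using s0(3)[OF s1(1)] by (intro filterlim_tendsto_pos_mult_at_top[OF tendsto_const]) auto
    then show ?thesis
      by (rule filterlim_at_top_mono) (use ge in \<open>auto simp: eventually_at_top_linorder\<close>)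
  qed
  have ratio: "((\<lambda>t. w t / f t) \<longlongrightarrow> 1) at_top"
  proof -
    have "((\<lambda>t. (exp t * w t) / (exp t * f t)) \<longlongrightarrow> 1) at_top"
    proof (rule lhospital_at_top_at_top[OF fe])
      show "\<forall>\<^sub>F t in at_top. DERIV (\<lambda>t. exp t * w t) t :> exp t * f t"
        using ev
      proof eventually_elim
        case (elim t)
        then show ?case
          using positive_DERIV[OF s0(1)[OF elim]] by (auto intro!: derivative_eq_intros simp: algebra_simps)
      qed
      show "\<forall>\<^sub>F t in at_top. DERIV (\<lambda>t. exp t * f t) t :> exp t * (f t - w t powr m)"
        using ev
      proof eventually_elim
        case (elim t)
        then show ?case
          using positive_DERIV[OF s0(1)[OF elim]] by (auto intro!: derivative_eq_intros simp: algebra_simps)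
      qed
      show "\<forall>\<^sub>F t in at_top. exp t * (f t - w t powr m) \<noteq> 0"
        using ev ev_half by eventually_elim (use s0(3) in fastforce)
      have "((\<lambda>t. 1 / (1 - w t powr m / f t)) \<longlongrightarrow> 1 / (1 - 0)) at_top"
        by (intro tendsto_intros q) auto
      moreover have "\<forall>\<^sub>F t in at_top. 1 / (1 - w t powr m / f t) = exp t * f t / (exp t * (f t - w t powr m))"
        using ev
      proof eventually_elim
        case (elim t)
        have "1 - w t powr m / f t = (f t - w t powr m) / f t"
          using s0(3)[OF elim] by (simp add: diff_divide_distrib)
        then show ?case by simp
      qed
      ultimately show "((\<lambda>t. exp t * f t / (exp t * (f t - w t powr m))) \<longlongrightarrow> 1) at_top"
        using tendsto_cong by force
    qed
    then show ?thesis by simp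
  qed
  have lin: "((\<lambda>t. f t powr (1 - m) / t) \<longlongrightarrow> m - 1) at_top"
  proof (rule lhospital_at_top_at_top)
    show "filterlim (\<lambda>t::real. t) at_top at_top" by (rule filterlim_ident)
    show "\<forall>\<^sub>F t in at_top. DERIV (\<lambda>t. f t powr (1 - m)) t :> (m - 1) * (w t / f t) powr m"
      using ev
    proof eventually_elim
      case (elim t)
      have "DERIV (\<lambda>t. f t powr (1 - m)) t :> (1 - m) * f t powr (- m) * (- (w t powr m))"
        using DERIV_chain2[OF has_real_derivative_powr[OF s0(3)[OF elim]] positive_DERIV(1)[OF s0(1)[OF elim]], of "1 - m"]
        by simp
      then show ?case
        using s0[OF elim] by (simp add: powr_divide powr_minus_divide field_simps)
    qed
    show "\<forall>\<^sub>F t in at_top. DERIV (\<lambda>t. t) t :> (1::real)" by simp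
    have "((\<lambda>t. (m - 1) * (w t / f t) powr m) \<longlongrightarrow> (m - 1) * 1 powr m) at_top"
      by (intro tendsto_intros ratio) auto
    then show "((\<lambda>t. (m - 1) * (w t / f t) powr m / 1) \<longlongrightarrow> m - 1) at_top" by simp
  qed simp
  have "((\<lambda>t. (f t powr (1 - m) / t) powr (- (1 / (m - 1)))) \<longlongrightarrow> (m - 1) powr (- (1 / (m - 1)))) at_top"
    using m by (intro tendsto_intros lin) auto
  moreover have "\<forall>\<^sub>F t in at_top. (f t powr (1 - m) / t) powr (- (1 / (m - 1))) = t powr (1 / (m - 1)) * f t"
    using ev
  proof eventually_elim
    case (elim t)
    have "(1 - m) * (- (1 / (m - 1))) = 1" using m by (simp add: field_simps)
    then have "(f t powr (1 - m)) powr (- (1 / (m - 1))) = f t"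
      using s0[OF elim] by (simp only: powr_powr) simp
    moreover have "t powr (- (1 / (m - 1))) = 1 / t powr (1 / (m - 1))"
      by (rule powr_minus_divide)
    ultimately show ?case
      using s0[OF elim] by (subst powr_divide) auto
  qed
  ultimately have "((\<lambda>t. t powr (1 / (m - 1)) * f t) \<longlongrightarrow> (m - 1) powr (- (1 / (m - 1)))) at_top"
    using tendsto_cong by force
  moreover have "(m - 1) powr (- (1 / (m - 1))) = (1 / (m - 1)) powr (1 / (m - 1))"
    using m by (subst powr_divide) (auto simp: powr_minus_divide)
  ultimately show ?thesis by simp
qed

text \<open>By \<open>positive_w_powr_le\<close> the function \<open>exp (m * t) * f\<close> is nondecreasing, so only an upper bound is
needed. When \<open>2 * f \<le> w\<close>, the function \<open>(2 / m) * w powr m - f\<close> decreases to \<open>0\<close>, whence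
\<open>f \<le> (2 / m) * w powr m\<close>, and it remains to bound \<open>exp t * w\<close>. Its logarithmic derivative
\<open>f / w\<close> is at most \<open>(2 / m) * w powr (m - 1)\<close>, and this is dominated by the decrease of a
multiple of \<open>w powr (m - 1)\<close>, since \<open>w' \<le> - w / 2\<close>.\<close>
lemma positive_fast_decay:
  assumes fast: "\<forall>t\<ge>s. 2 * f t \<le> w t"
  shows "\<exists>l>0. ((\<lambda>t. exp (m * t) * f t) \<longlongrightarrow> l) at_top"
proof -
  define s0 where "s0 = max 1 s"
  have s0: "0 < t" "0 < f t" "0 < w t" "2 * f t \<le> w t" if "s0 \<le> t" for t
    using that fast[rule_format, of t] positive_f[of t] positive_w[of t] by (auto simp: s0_def)
  have upper: "f t \<le> 2 / m * w t powr m" if t: "s0 \<le> t" for t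
  proof -
    have "0 \<le> 2 / m * w t powr m - f t"
    proof (rule limit_le_if_DERIV_nonpos[where u = "\<lambda>t. 2 / m * w t powr m - f t"])
      have "((\<lambda>t. 2 / m * w t powr m - f t) \<longlongrightarrow> 2 / m * 0 - 0) at_top"
        using m by (intro tendsto_intros positive_tendsto_zero positive_w_powr_tendsto_zero) auto
      then show "((\<lambda>t. 2 / m * w t powr m - f t) \<longlongrightarrow> 0) at_top" by simp
      fix x assume x: "t \<le> x"
      note sx = s0[OF order_trans[OF t x]]
      have "DERIV (\<lambda>t. 2 / m * w t powr m - f t) x :>
          2 / m * (m * w x powr (m - 1) * (f x - w x)) - (- (w x powr m))"
        by (intro DERIV_diff DERIV_cmult positive_DERIV positive_DERIV_powr sx)
      moreover have "2 / m * (m * w x powr (m - 1) * (f x - w x)) - (- (w x powr m))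
          = w x powr (m - 1) * (2 * f x - w x)"
        using m sx(3) by (subst powr_split) (auto simp: algebra_simps)
      ultimately show "DERIV (\<lambda>t. 2 / m * w t powr m - f t) x :> w x powr (m - 1) * (2 * f x - w x)"
        by simp
      show "w x powr (m - 1) * (2 * f x - w x) \<le> 0"
        using sx by (intro mult_nonneg_nonpos) auto
    qed
    then show ?thesis by simp
  qed
  define c where "c = 4 / m / (m - 1)"
  have c0: "0 < c" using m by (simp add: c_def)
  have cm: "c * (m - 1) = 4 / m"
    by (rule nonzero_eq_divide_eq[THEN iffD1, OF _ c_def]) (use m in simp)
  \<comment> \<open>The constant \<open>c\<close> makes the last summand decrease at least as fast as \<open>ln w + t\<close> can grow.\<close>
  define h where "h t = ln (w t) + t + c * w t powr (m - 1)" for t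
  have h: "h t \<le> h s0" if t: "s0 \<le> t" for t
  proof (rule DERIV_nonpos_imp_nonincreasing[where f = h, OF t])
    fix x assume x: "s0 \<le> x" "x \<le> t"
    note sx = s0[OF x(1)]
    have "DERIV h x :> (f x - w x) / w x + 1 + c * ((m - 1) * w x powr (m - 1 - 1) * (f x - w x))"
      unfolding h_def using sx
      by (intro DERIV_add DERIV_cmult positive_DERIV_powr DERIV_ident)
        (auto intro!: derivative_eq_intros positive_DERIV)
    moreover have "(f x - w x) / w x + 1 + c * ((m - 1) * w x powr (m - 1 - 1) * (f x - w x)) \<le> 0"
    proof -
      have wm: "w x powr (m - 1) = w x powr (m - 1 - 1) * w x"
        using sx by (intro powr_split) auto
      have "f x / w x \<le> 2 / m * w x powr (m - 1)"
        using upper[OF x(1)] powr_split[of "w x" m] sx by (simp add: field_simps)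
      moreover have "c * ((m - 1) * w x powr (m - 1 - 1) * (f x - w x)) =
          4 / m * (w x powr (m - 1 - 1) * (f x - w x))"
        by (simp flip: cm)
      moreover have "4 / m * (w x powr (m - 1 - 1) * (f x - w x)) \<le> 4 / m * (w x powr (m - 1 - 1) * (- (w x / 2)))"
        using sx m by (intro mult_left_mono) auto
      moreover have "4 / m * (w x powr (m - 1 - 1) * (- (w x / 2))) = - (2 / m * w x powr (m - 1))"
        by (simp add: wm)
      moreover have "(f x - w x) / w x + 1 = f x / w x"
        using sx by (simp add: diff_divide_distrib)
      ultimately show ?thesis by linarith
    qed
    ultimately show "\<exists>y. DERIV h x :> y \<and> y \<le> 0" by blast
  qed
  have w_bound: "exp t * w t \<le> exp (h s0)" if t: "s0 \<le> t" for t
  proof -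
    have "ln (w t) + t \<le> h t" using c0 by (simp add: h_def)
    with h[OF t] have "exp (ln (w t) + t) \<le> exp (h s0)" by simp
    then show ?thesis using s0(3)[OF t] by (simp add: exp_add mult.commute)
  qed
  have bound: "exp (m * t) * f t \<le> 2 / m * exp (h s0) powr m" if t: "s0 \<le> t" for t
  proof -
    have "exp (m * t) * f t \<le> exp (m * t) * (2 / m * w t powr m)"
      using upper[OF t] by (intro mult_left_mono) auto
    also have "\<dots> = 2 / m * (exp t * w t) powr m"
      using s0(3)[OF t] by (simp add: powr_mult exp_powr_real mult.commute)
    also have "\<dots> \<le> 2 / m * exp (h s0) powr m"
      using m s0(3)[OF t] by (intro mult_left_mono powr_mono2 w_bound t) auto
    finally show ?thesis .
  qed
  have mono: "exp (m * r) * f r \<le> exp (m * t) * f t" if "s0 \<le> r" "r \<le> t" for r t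
  proof (rule DERIV_nonneg_imp_nondecreasing[where f = "\<lambda>t. exp (m * t) * f t", OF that(2)])
    fix x assume x: "r \<le> x" "x \<le> t"
    have x0: "0 < x" using x s0(1)[of x] that by auto
    have "DERIV (\<lambda>t. exp (m * t) * f t) x :> exp (m * x) * (m * f x - w x powr m)"
      using positive_DERIV(1)[OF x0] by (auto intro!: derivative_eq_intros simp: algebra_simps)
    moreover have "0 \<le> exp (m * x) * (m * f x - w x powr m)"
      using positive_w_powr_le[OF x0] by simp
    ultimately show "\<exists>y. DERIV (\<lambda>t. exp (m * t) * f t) x :> y \<and> 0 \<le> y" by blast
  qed
  obtain l where l: "exp (m * s0) * f s0 \<le> l" "((\<lambda>t. exp (m * t) * f t) \<longlongrightarrow> l) at_top"
    using bounded_nondecreasing_tendsto_at_top[of s0 "\<lambda>t. exp (m * t) * f t", OF mono bound] by auto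
  have "0 < exp (m * s0) * f s0" using s0(2)[of s0] by simp
  with l show ?thesis by (intro exI[of _ l]) auto
qed

lemma positive_untrapped_fast:
  assumes "\<And>t. \<not> trapped_at m f w t"
  shows "\<exists>s. \<forall>t\<ge>s. 2 * f t \<le> w t"
proof -
  have "\<forall>\<^sub>F t in at_top. f t < trap_level m \<and> w t < trap_level m \<and> 0 \<le> t"
    by (intro eventually_conj order_tendstoD(2)[OF positive_tendsto_zero(1)]
        order_tendstoD(2)[OF positive_tendsto_zero(2)] trap_level_pos eventually_ge_at_top)
  then have "\<forall>\<^sub>F t in at_top. 2 * f t \<le> w t"
    by eventually_elim (use assms positive_f in \<open>force simp: trapped_at_def\<close>)
  then show ?thesis by (simp add: eventually_at_top_linorder)
qed

text \<open>Reaching the origin means dissipating the whole energy \<open>a\<^sup>2 / 2\<close>. As the energy never increases,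
\<open>w \<le> W\<close>, where \<open>W\<close> is of order \<open>a powr (2 / (m + 1))\<close>. The dissipation \<open>w powr m * w\<close> is at most
\<open>W\<close> times the decrease of \<open>f\<close>, so in total at most \<open>W * a\<close>. For large \<open>a\<close> this is
less than \<open>a\<^sup>2 / 2\<close>.\<close>
lemma positive_initial_bounded:
  assumes a: "0 < a"
  shows "a \<le> 2 * (2 * (m + 1)) powr (1 / (m - 1))"
proof -
  define W where "W = ((m + 1) * (a\<^sup>2 / 2)) powr (1 / (m + 1))"
  note cont = trajectory_continuous[OF fw]
  have pp: "p_power (m + 1) (w t) * \<bar>w t\<bar> = w t powr m * w t" if "0 < t" for t
    using positive_w[OF that] by (simp add: p_power_pos)
  have der: "DERIV (\<lambda>t. energy m (f t) (w t)) t :> - (w t powr m * w t)" if "0 < t" for t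
    using DERIV_energy[OF m trajectory_DERIV[OF fw that]] by (simp add: pp[OF that])
  have init: "energy m (f 0) (w 0) = a\<^sup>2 / 2"
    using m by (simp add: energy_def trajectory_init[OF fw])
  have wW: "w t \<le> W" if t: "0 < t" for t
  proof -
    have "energy m (f t) (w t) \<le> energy m (f 0) (w 0)"
    proof (rule nonincreasing_if_DERIV_nonpos[where u = "\<lambda>t. energy m (f t) (w t)"])
      fix x assume x: "0 < x" "x < t"
      show "DERIV (\<lambda>t. energy m (f t) (w t)) x :> - (w x powr m * w x)"
        by (rule der[OF x(1)])
      show "- (w x powr m * w x) \<le> 0" using positive_w[OF x(1)] by simp
    qed (use t in \<open>auto intro!: continuous_on_energy m cont\<close>)
    then have "(m + 1) * energy m (f t) (w t) \<le> (m + 1) * (a\<^sup>2 / 2)"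
      unfolding init using m by (intro mult_left_mono) auto
    from order_trans[OF abs_powr_le_energy[OF m] this] have "\<bar>w t\<bar> \<le> W"
      unfolding W_def using m by (subst powr_inverse_le_iff) simp_all
    then show ?thesis by simp
  qed
  \<comment> \<open>This function is nondecreasing with limit \<open>0\<close>, hence nonpositive at \<open>t = 0\<close>.\<close>
  define u where "u t = energy m (f t) (w t) - W * f t" for t
  have du: "DERIV u t :> w t powr m * (W - w t)" if "0 < t" for t
    unfolding u_def using der[OF that] positive_DERIV(1)[OF that]
    by (auto intro!: derivative_eq_intros simp: algebra_simps)
  have du_nonneg: "0 \<le> w t powr m * (W - w t)" if "0 < t" for t
    using wW[OF that] by simp
  have "u 0 \<le> u 1"
    by (rule nondecreasing_if_DERIV_nonneg[OF _ _ du du_nonneg])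
      (auto simp: u_def[abs_def] intro!: continuous_intros continuous_on_energy m cont)
  moreover have "0 \<le> - u 1"
  proof (rule limit_le_if_DERIV_nonpos[where u = "\<lambda>t. - u t"])
    have "\<forall>\<^sub>F t in at_top. (f t)\<^sup>2 / 2 + w t powr (m + 1) / (m + 1) - W * f t = u t"
      using eventually_gt_at_top[of 0]
      by eventually_elim (simp add: u_def energy_def abs_of_pos positive_w)
    moreover have "((\<lambda>t. (f t)\<^sup>2 / 2 + w t powr (m + 1) / (m + 1) - W * f t) \<longlongrightarrow>
        0\<^sup>2 / 2 + 0 / (m + 1) - W * 0) at_top"
      using m by (intro tendsto_intros positive_tendsto_zero positive_w_powr_tendsto_zero) auto
    ultimately have "(u \<longlongrightarrow> 0) at_top" using tendsto_cong by force
    then show "((\<lambda>t. - u t) \<longlongrightarrow> 0) at_top" using tendsto_minus by force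
  next
    fix t :: real assume "1 \<le> t"
    then have t: "0 < t" by simp
    show "DERIV (\<lambda>t. - u t) t :> - (w t powr m * (W - w t))" by (intro DERIV_minus du t)
    show "- (w t powr m * (W - w t)) \<le> 0" using du_nonneg[OF t] by simp
  qed
  ultimately have "a\<^sup>2 / 2 \<le> W * a"
    using init by (simp add: u_def trajectory_init[OF fw])
  then have "a / 2 \<le> W" using a by (simp add: power2_eq_square)
  then have "(a / 2) powr (m + 1) \<le> (m + 1) * (a\<^sup>2 / 2)"
    unfolding W_def using a m by (subst (asm) powr_inverse_le_iff) auto
  moreover have "(a / 2) powr (m + 1) = (a / 2) powr (m - 1) * (a / 2)\<^sup>2"
  proof -
    have "(a / 2) powr (m + 1) = (a / 2) powr (m - 1 + 2)" by (simp add: add.commute)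
    also have "\<dots> = (a / 2) powr (m - 1) * (a / 2) powr 2" by (rule powr_add)
    finally show ?thesis using a by simp
  qed
  moreover have "(m + 1) * (a\<^sup>2 / 2) = 2 * (m + 1) * (a / 2)\<^sup>2" by (simp add: power2_eq_square)
  ultimately have "(a / 2) powr (m - 1) \<le> 2 * (m + 1)"
    using a mult_le_cancel_right_pos[of "(a / 2)\<^sup>2" "(a / 2) powr (m - 1)" "2 * (m + 1)"] by simp
  then have "a / 2 \<le> (2 * (m + 1)) powr (1 / (m - 1))"
    using a m by (subst powr_inverse_le_iff) auto
  then show ?thesis by simp
qed

end

section \<open>Comparison of two orbits\<close>

lemma powr_above_tangent:
  fixes x y b :: real
  assumes "1 \<le> b" "0 < x" "0 < y"
  shows "x powr b + b * x powr (b - 1) * (y - x) \<le> y powr b"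
proof -
  have "b * x powr (b - 1) * (y - x) \<le> y powr b - x powr b"
  proof (rule convex_on_imp_above_tangent[OF powr_convex[OF assms(1)]])
    show "((\<lambda>x. x powr b) has_field_derivative b * x powr (b - 1)) (at x within {0<..})"
      using assms by (intro has_field_derivative_at_within[OF has_real_derivative_powr])
  qed (use assms in \<open>auto simp: interior_open\<close>)
  then show ?thesis by simp
qed

text \<open>Along the orbit from \<open>b\<close>, the first component \<open>g\<close> decreases from \<open>b\<close> to \<open>0\<close> and can serve as
coordinate. The energy \<open>F y\<close> of that orbit at the point with first component \<open>y\<close> has the derivative
\<open>F' = V\<close>, where \<open>V y\<close> is its second component there. Along the orbit from \<open>a\<close>, the gap
\<open>\<Delta> t = F (f t) - energy m (f t) (w t)\<close> has derivative \<open>- w powr m * (V - w)\<close>. The tangent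
inequality at \<open>w\<close> for \<open>z powr (m + 1)\<close> bounds \<open>w powr m * (V - w)\<close> by \<open>\<Delta>\<close> whatever the sign of \<open>V - w\<close>, so
\<open>exp t * \<Delta> t\<close> is nondecreasing. Finally \<open>\<Delta> t\<close> is at most \<open>V powr (m + 1) / (m + 1)\<close>, which
\<open>positive_w_powr_le\<close> bounds by a power of \<open>f\<close>.\<close>
lemma positive_orbit_dominates:
  assumes m: "1 < m" and fw: "trajectory m a f w" and gv: "trajectory m b g v"
    and ab: "0 < a" "a < b" and g_pos: "\<forall>t\<ge>0. 0 < g t"
  shows "\<exists>c>0. \<forall>t\<ge>0. (\<forall>s. 0 \<le> s \<and> s \<le> t \<longrightarrow> 0 < f s) \<longrightarrow>
    c * exp (- t) \<le> (m * f t) powr ((m + 1) / m)"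
proof -
  note g_dec = positive_f_decreasing[OF m gv g_pos]
  note v_pos = positive_w[OF m gv g_pos]
  note g_der = positive_DERIV[OF m gv g_pos]
  have g_inj: "s = t" if "0 \<le> s" "0 \<le> t" "g s = g t" for s t
    using g_dec[of s t] g_dec[of t s] that by (cases s t rule: linorder_cases) auto
  define N where "N y = (SOME t. 0 \<le> t \<and> g t = y)" for y
  have N: "0 \<le> N y" "g (N y) = y" if y: "0 < y" "y \<le> b" for y
  proof -
    have "\<forall>\<^sub>F t in at_top. g t < y \<and> 0 \<le> t"
      by (intro eventually_conj order_tendstoD(2)[OF positive_tendsto_zero(2)[OF m gv g_pos]]
          eventually_ge_at_top y)
    from eventually_happens'[OF _ this] obtain r where "g r < y" "0 \<le> r" by auto
    then have "\<exists>t. 0 \<le> t \<and> t \<le> r \<and> g t = y"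
      using y trajectory_init(1)[OF gv] by (intro IVT2' trajectory_continuous[OF gv]) auto
    then have "\<exists>t. 0 \<le> t \<and> g t = y" by blast
    from someI_ex[OF this] show "0 \<le> N y" "g (N y) = y" by (auto simp: N_def)
  qed
  have Ng: "N (g t) = t" if "0 \<le> t" for t
  proof -
    have gb: "g t \<le> b" using g_dec[of 0 t] that trajectory_init(1)[OF gv] by (cases "t = 0") auto
    show ?thesis
      by (rule g_inj[OF _ that]) (use gb N[of "g t"] g_pos that in auto)
  qed
  have N_pos: "0 < N y" if "0 < y" "y < b" for y
    using N[of y] that trajectory_init(1)[OF gv] by (cases "N y = 0") auto
  have N_der: "DERIV N y :> inverse (- (v (N y) powr m))" if y: "0 < y" "y < b" for y
  proof (rule DERIV_inverse_function[where f = g and a = 0 and b = b])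
    have Ny: "0 < N y" "g (N y) = y" using N_pos N(2) y by auto
    have "isCont N (g (N y))"
    proof (rule isCont_inverse_function2[where a = "N y / 2" and b = "N y + 1" and f = g and g = N])
      fix z assume "N y / 2 \<le> z"
      then have z: "0 < z" using Ny by linarith
      show "N (g z) = z" using Ng z by simp
      show "isCont g z" by (rule DERIV_isCont[OF g_der(1)[OF z]])
    qed (use Ny(1) in simp_all)
    then show "isCont N y" by (simp only: Ny)
    show "DERIV g (N y) :> - (v (N y) powr m)" by (rule g_der(1)[OF Ny(1)])
    show "- (v (N y) powr m) \<noteq> 0" using v_pos[OF Ny(1)] by simp
    show "g (N z) = z" if "0 < z" "z < b" for z using N(2) that by simp
  qed (rule y)+
  define V where "V y = v (N y)" for y
  have V_pos: "0 < V y" if "0 < y" "y < b" for y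
    unfolding V_def using v_pos N_pos that by blast
  define F where "F y = energy m (g (N y)) (V y)" for y
  have F_der: "DERIV F y :> V y" if y: "0 < y" "y < b" for y
  proof -
    have "DERIV F y :> - (p_power (m + 1) (V y) * \<bar>V y\<bar>) * inverse (- (V y powr m))"
      unfolding F_def V_def
      by (rule DERIV_chain2[where f = "\<lambda>t. energy m (g t) (v t)"],
          rule DERIV_energy[OF m trajectory_DERIV[OF gv N_pos[OF y]]], rule N_der[OF y])
    moreover have "- (p_power (m + 1) (V y) * \<bar>V y\<bar>) * inverse (- (V y powr m)) = V y"
      using V_pos[OF y] by (simp add: p_power_pos)
    ultimately show ?thesis by simp
  qed
  define \<Delta> where "\<Delta> t = F (f t) - energy m (f t) (w t)" for t
  have \<Delta>_eq: "\<Delta> t = (V (f t) powr (m + 1) - \<bar>w t\<bar> powr (m + 1)) / (m + 1)" if "0 < f t" "f t < b" for t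
    using N(2)[of "f t"] V_pos[of "f t"] that by (simp add: \<Delta>_def F_def energy_def diff_divide_distrib)
  have "V a powr (m + 1) * exp (- t) \<le> (m * f t) powr ((m + 1) / m)"
    if t: "0 \<le> t" and f_pos: "\<And>s. 0 \<le> s \<Longrightarrow> s \<le> t \<Longrightarrow> 0 < f s" for t
  proof -
    have pos: "\<forall>s\<in>{0..<t}. 0 < f s" using f_pos by simp
    note w_pos = trajectory_w_pos[OF fw pos] and f_der = trajectory_DERIV_pos[OF fw pos]
    note cont = trajectory_continuous[OF fw]
    have f_lt: "f s < b" if s: "0 \<le> s" "s \<le> t" for s
    proof -
      have "f s \<le> f 0"
        by (rule nonincreasing_if_DERIV_nonpos[OF s(1), where u' = "\<lambda>s. - (w s powr m)"])
          (use s in \<open>auto intro!: cont f_der\<close>)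
      then show ?thesis using ab by (simp add: trajectory_init[OF fw])
    qed
    have "exp 0 * \<Delta> 0 \<le> exp t * \<Delta> t"
    proof (rule nondecreasing_if_DERIV_nonneg[where u = "\<lambda>t. exp t * \<Delta> t", OF t])
      have "continuous_on {0<..<b} F"
        using F_der by (auto intro!: DERIV_continuous_on[OF has_field_derivative_at_within])
      then have "continuous_on {0..t} (\<lambda>s. F (f s))"
        by (rule continuous_on_compose2) (use f_pos f_lt in \<open>auto intro!: cont\<close>)
      then show "continuous_on {0..t} (\<lambda>t. exp t * \<Delta> t)"
        unfolding \<Delta>_def by (intro continuous_intros continuous_on_energy m cont) auto
      fix x assume x: "0 < x" "x < t"
      define y z where "y = V (f x)" and "z = w x"
      have fx: "0 < f x" "f x < b" using x by (auto intro!: f_pos f_lt)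
      have yz: "0 < y" "0 < z" using x fx by (auto simp: y_def z_def intro!: V_pos w_pos)
      have "DERIV f x :> - (w x powr m)" using x by (intro f_der(1)) auto
      from DERIV_chain2[where f = F, OF F_der[OF fx] this]
      have Ff: "DERIV (\<lambda>t. F (f t)) x :> y * (- (z powr m))" by (simp add: y_def z_def)
      have "DERIV \<Delta> x :> y * (- (z powr m)) - (- (p_power (m + 1) z * \<bar>z\<bar>))"
        using DERIV_diff[OF Ff DERIV_energy[OF m trajectory_DERIV[OF fw x(1)]]]
        by (simp add: \<Delta>_def[abs_def] z_def)
      then have "DERIV \<Delta> x :> - (z powr m * (y - z))"
        using yz by (simp add: p_power_pos algebra_simps)
      then show "DERIV (\<lambda>t. exp t * \<Delta> t) x :> exp x * (\<Delta> x - z powr m * (y - z))"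
        by (auto intro!: derivative_eq_intros simp: algebra_simps)
      have "z powr (m + 1) + (m + 1) * z powr m * (y - z) \<le> y powr (m + 1)"
        using powr_above_tangent[of "m + 1" z y] m yz by simp
      moreover have "(m + 1) * z powr m * (y - z) = z powr m * (y - z) * (m + 1)"
        by (simp only: mult_ac)
      ultimately have "z powr m * (y - z) * (m + 1) \<le> y powr (m + 1) - z powr (m + 1)"
        by linarith
      then have "z powr m * (y - z) \<le> \<Delta> x"
        using m yz by (simp add: \<Delta>_eq[OF fx] pos_le_divide_eq flip: y_def z_def)
      then show "0 \<le> exp x * (\<Delta> x - z powr m * (y - z))" by simp
    qed
    moreover have "\<Delta> 0 = V a powr (m + 1) / (m + 1)"
      using \<Delta>_eq[of 0] ab m by (simp add: trajectory_init[OF fw])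
    ultimately have "V a powr (m + 1) / (m + 1) \<le> \<Delta> t * exp t" by (simp add: mult.commute)
    then have "V a powr (m + 1) / (m + 1) * exp (- t) \<le> \<Delta> t * exp t * exp (- t)"
      by (rule mult_right_mono) simp
    then have 1: "V a powr (m + 1) / (m + 1) * exp (- t) \<le> \<Delta> t"
      by (simp add: mult.assoc flip: exp_add)
    have ft: "0 < f t" "f t < b" using t by (auto intro!: f_pos f_lt)
    have "V (f t) powr m \<le> m * f t"
      using positive_w_powr_le[OF m gv g_pos N_pos[OF ft]] N(2)[of "f t"] ft by (simp add: V_def)
    then have "V (f t) \<le> (m * f t) powr (1 / m)"
      using m ft V_pos[OF ft] by (subst powr_inverse_le_iff) auto
    then have "V (f t) powr (m + 1) \<le> ((m * f t) powr (1 / m)) powr (m + 1)"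
      using m V_pos[OF ft] by (intro powr_mono2) auto
    also have "\<dots> = (m * f t) powr ((m + 1) / m)"
      by (simp add: powr_powr)
    finally have "\<Delta> t \<le> (m * f t) powr ((m + 1) / m) / (m + 1)"
      unfolding \<Delta>_eq[OF ft] using m powr_ge_zero[of "\<bar>w t\<bar>" "m + 1"]
      by (intro divide_right_mono) linarith+
    with 1 have "V a powr (m + 1) * exp (- t) / (m + 1) \<le> (m * f t) powr ((m + 1) / m) / (m + 1)"
      by simp
    then show ?thesis using m by (simp add: divide_le_cancel)
  qed
  moreover have "0 < V a powr (m + 1)" using V_pos[of a] ab by simp
  ultimately show ?thesis by blast
qed

text \<open>The lower bound from \<open>positive_orbit_dominates\<close> is violated at a zero of \<open>f\<close>, and also by a positive
untrapped trajectory: for the latter \<open>f\<close> is of order \<open>exp (- m * t)\<close>, so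
the right-hand side is of order \<open>exp (- (m + 1) * t)\<close>, which is smaller than \<open>exp (- t)\<close>.\<close>
lemma below_positive_trapped:
  assumes m: "1 < m" and fw: "trajectory m a f w" and gv: "trajectory m b g v"
    and ab: "0 < a" "a < b" and g_pos: "\<forall>t\<ge>0. 0 < g t"
  shows "\<exists>s. trapped_at m f w s"
proof (rule ccontr)
  assume untrapped: "\<not> ?thesis"
  obtain c where c: "0 < c" and "\<forall>t\<ge>0. (\<forall>s. 0 \<le> s \<and> s \<le> t \<longrightarrow> 0 < f s) \<longrightarrow>
      c * exp (- t) \<le> (m * f t) powr ((m + 1) / m)"
    using positive_orbit_dominates[OF assms] by auto
  then have dominates: "c * exp (- t) \<le> (m * f t) powr ((m + 1) / m)"
    if "0 \<le> t" "\<forall>s. 0 \<le> s \<and> s \<le> t \<longrightarrow> 0 < f s" for t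
    using that by simp
  have f_pos: "\<forall>t\<ge>0. 0 < f t"
  proof (rule ccontr)
    assume "\<not> ?thesis"
    then obtain t where t: "0 \<le> t" "f t \<le> 0" by force
    then have "\<exists>r. 0 < r \<and> r \<le> t \<and> f r = 0 \<and> (\<forall>s. 0 \<le> s \<and> s < r \<longrightarrow> 0 < f s)"
      using ab trajectory_init(1)[OF fw]
      by (intro first_nonpos_point trajectory_continuous[OF fw]) auto
    then obtain r where r: "0 < r" "f r = 0" "\<And>s. 0 \<le> s \<Longrightarrow> s < r \<Longrightarrow> 0 < f s" by auto
    have "0 \<le> f s" if "0 \<le> s" "s \<le> r" for s
      using r(2) r(3)[of s] that by (cases "s = r") auto
    then have "continuous_on {0..r} (\<lambda>t. (m * f t) powr ((m + 1) / m))"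
      using m by (intro continuous_on_powr' continuous_intros trajectory_continuous[OF fw]) auto
    then have "continuous_on (closure {0..<r}) (\<lambda>t. (m * f t) powr ((m + 1) / m) - c * exp (- t))"
      using r(1) by (auto intro!: continuous_intros)
    then have "0 \<le> (m * f r) powr ((m + 1) / m) - c * exp (- r)"
    proof (rule continuous_ge_on_closure)
      fix s assume s: "s \<in> {0..<r}"
      then have "c * exp (- s) \<le> (m * f s) powr ((m + 1) / m)"
        using r(3) by (intro dominates) auto
      then show "0 \<le> (m * f s) powr ((m + 1) / m) - c * exp (- s)" by simp
    qed (use r(1) in simp)
    then show False using r(2) mult_pos_pos[OF c exp_gt_zero[of "- r"]] by simp
  qed
  obtain l where "0 < l" and l: "((\<lambda>t. exp (m * t) * f t) \<longlongrightarrow> l) at_top"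
    using positive_untrapped_fast[OF m fw f_pos] positive_fast_decay[OF m fw f_pos] untrapped by blast
  define C where "C = (m * (l + 1)) powr ((m + 1) / m)"
  have "\<forall>\<^sub>F t in at_top. exp (m * t) * f t < l + 1"
    by (rule order_tendstoD(2)[OF l]) simp
  moreover have "\<forall>\<^sub>F t in at_top. C / c < exp (m * t)"
  proof -
    have "filterlim (\<lambda>t. m * t) at_top at_top"
      using m by (intro filterlim_tendsto_pos_mult_at_top[OF tendsto_const] filterlim_ident) auto
    from filterlim_compose[OF exp_at_top this] show ?thesis
      by (simp add: filterlim_at_top_dense)
  qed
  ultimately have "\<forall>\<^sub>F t in at_top. exp (m * t) * f t < l + 1 \<and> C / c < exp (m * t) \<and> 0 \<le> t"
    using eventually_ge_at_top[of 0] by eventually_elim auto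
  from eventually_happens'[OF _ this]
  obtain t where t: "exp (m * t) * f t < l + 1" "C / c < exp (m * t)" "0 \<le> t"
    by auto
  have "c * exp (- t) \<le> (m * f t) powr ((m + 1) / m)"
    using f_pos t by (intro dominates) auto
  also have "\<dots> \<le> (m * ((l + 1) * exp (- (m * t)))) powr ((m + 1) / m)"
  proof (intro powr_mono2 mult_left_mono)
    show "f t \<le> (l + 1) * exp (- (m * t))"
      using t(1) by (simp add: exp_minus field_simps)
    show "0 \<le> m * f t" using f_pos m t by (intro mult_nonneg_nonneg) (auto intro: less_imp_le)
  qed (use m in auto)
  also have "\<dots> = C * exp (- (m * t)) powr ((m + 1) / m)"
    using \<open>0 < l\<close> m by (simp add: C_def powr_mult mult.assoc[symmetric])
  also have "exp (- (m * t)) powr ((m + 1) / m) = exp (- (m * t)) * exp (- t)"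
  proof -
    have "- (m * t) * ((m + 1) / m) = - (m * t) + - t" using m by (simp add: field_simps)
    then show ?thesis by (simp only: exp_powr_real exp_add)
  qed
  finally have "c * exp (- t) \<le> C * exp (- (m * t)) * exp (- t)" by (simp only: mult.assoc)
  then have "c \<le> C * exp (- (m * t))" by simp
  then have "c * exp (m * t) \<le> C" by (simp add: exp_minus field_simps)
  then show False using t(2) c by (simp add: divide_less_eq mult.commute)
qed

section \<open>First zeros, and openness of the two regimes\<close>

lemma trajectory_first_zero:
  assumes m: "1 < m" and fw: "trajectory m a f w" and a: "0 < a" and "\<not> (\<forall>t\<ge>0. 0 < f t)"
  shows "\<exists>r>0. f r = 0 \<and> 0 < w r \<and> (\<forall>t. 0 \<le> t \<and> t < r \<longrightarrow> 0 < f t)"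
proof -
  obtain t where t: "0 \<le> t" "f t \<le> 0" using assms by force
  then have "\<exists>r. 0 < r \<and> r \<le> t \<and> f r = 0 \<and> (\<forall>s. 0 \<le> s \<and> s < r \<longrightarrow> 0 < f s)"
    using a trajectory_init(1)[OF fw]
    by (intro first_nonpos_point trajectory_continuous[OF fw]) auto
  then obtain r where r: "0 < r" "f r = 0" "\<forall>s. 0 \<le> s \<and> s < r \<longrightarrow> 0 < f s" by blast
  moreover have "0 < w r" using r by (intro trajectory_w_pos[OF fw, where T = r]) auto
  ultimately show ?thesis by blast
qed

text \<open>Since \<open>w > 0\<close> at the first zero, \<open>f\<close> becomes strictly negative, and a strict inequality at a fixed
time survives small changes of \<open>a\<close>.\<close>
lemma nonpositive_open:
  assumes m: "1 < m" and fw: "trajectory m a f w" and a: "0 < a" and "\<not> (\<forall>t\<ge>0. 0 < f t)"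
  shows "\<exists>d>0. \<forall>b g v. \<bar>b - a\<bar> < d \<longrightarrow> trajectory m b g v \<longrightarrow> \<not> (\<forall>t\<ge>0. 0 < g t)"
proof -
  obtain r where r: "0 < r" "f r = 0" "0 < w r" using trajectory_first_zero[OF assms] by blast
  have "DERIV f r :> - (w r powr m)"
    using trajectory_DERIV(1)[OF fw r(1)] r(3) by (simp add: p_power_pos)
  then obtain e where e: "e > 0" "\<forall>h>0. h < e \<longrightarrow> f (r + h) < f r"
    using DERIV_neg_dec_right[of f "- (w r powr m)" r] r(3) by auto
  define q where "q = r + e / 2"
  have q: "0 < q" "f q < 0" using e r by (auto simp: q_def)
  obtain d where "d > 0" and d: "\<forall>b g v t. \<bar>b - a\<bar> < d \<longrightarrow> trajectory m b g v \<longrightarrow> 0 \<le> t \<longrightarrow> t \<le> q \<longrightarrow>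
      \<bar>g t - f t\<bar> < - f q \<and> \<bar>v t - w t\<bar> < - f q"
    using trajectory_close[OF m fw, of "- f q" q] q by auto
  have "\<not> (\<forall>t\<ge>0. 0 < g t)" if "\<bar>b - a\<bar> < d" "trajectory m b g v" for b g v
  proof -
    have "\<bar>g q - f q\<bar> < - f q" using d that q by force
    then have "g q < 0" by linarith
    then show ?thesis using q by (metis less_imp_le not_less_iff_gr_or_eq)
  qed
  then show ?thesis using \<open>d > 0\<close> by blast
qed

lemma trapped_open:
  assumes m: "1 < m" and fw: "trajectory m a f w" and trap: "trapped_at m f w s"
  shows "\<exists>d>0. \<forall>b g v. \<bar>b - a\<bar> < d \<longrightarrow> trajectory m b g v \<longrightarrow> trapped_at m g v s"
proof -
  have f_pos: "\<forall>t\<ge>0. 0 < f t" using trapped_forever(1)[OF assms] by blast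
  have s: "0 \<le> s" "f s < trap_level m" "w s < trap_level m" "w s < 2 * f s"
    using trap by (auto simp: trapped_at_def)
  \<comment> \<open>A perturbation by \<open>e\<close> in both components changes \<open>2 * f - w\<close> by less than \<open>3 * e\<close>.\<close>
  define e where "e = Min {f s, trap_level m - f s, trap_level m - w s, (2 * f s - w s) / 3}"
  have e: "0 < e" "e \<le> f s" "e \<le> trap_level m - f s" "e \<le> trap_level m - w s" "3 * e \<le> 2 * f s - w s"
  proof -
    have "e \<le> (2 * f s - w s) / 3" unfolding e_def by (rule Min_le) auto
    then show "3 * e \<le> 2 * f s - w s" by simp
  qed (use s f_pos in \<open>auto simp: e_def\<close>)
  obtain d where "d > 0" and d: "\<And>b g v t. \<bar>b - a\<bar> < d \<Longrightarrow> trajectory m b g v \<Longrightarrow> 0 \<le> t \<Longrightarrow> t \<le> s \<Longrightarrow>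
      \<bar>g t - f t\<bar> < e \<and> \<bar>v t - w t\<bar> < e"
    using trajectory_close[OF m fw e(1), of s] by blast
  have "trapped_at m g v s" if b: "\<bar>b - a\<bar> < d" "trajectory m b g v" for b g v
  proof -
    have "0 < g t" if "0 \<le> t" "t \<le> s" for t
    proof -
      have "f s \<le> f t"
        using positive_f_decreasing[OF m fw f_pos, of t s] that by (cases "t = s") auto
      then show ?thesis using d[OF b that] e(2) by linarith
    qed
    moreover have "g s < trap_level m" "v s < trap_level m" "v s < 2 * g s"
      using d[OF b s(1) order_refl] e by linarith+
    ultimately show ?thesis using s(1) by (auto simp: trapped_at_def)
  qed
  then show ?thesis using \<open>d > 0\<close> by blast
qed

lemma first_zero_eq:
  assumes "0 < r" "f r = 0" "\<And>t. 0 < t \<Longrightarrow> t < r \<Longrightarrow> f t \<noteq> 0"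
  shows "first_zero f = ereal r"
  unfolding first_zero_def
proof (rule Inf_eqI)
  fix x assume "x \<in> ereal ` {r. 0 < r \<and> f r = 0}"
  then show "ereal r \<le> x" using assms(3) by force
qed (use assms in auto)

lemma first_zero_infinity:
  assumes "\<forall>t\<ge>0. 0 < f t"
  shows "first_zero f = \<infinity>"
proof -
  have "f r \<noteq> 0" if "0 < r" for r using assms[rule_format, of r] that by simp
  then have no_zero: "{r. 0 < r \<and> f r = 0} = {}" by auto
  show ?thesis unfolding first_zero_def no_zero by (simp add: top_ereal_def)
qed

section \<open>The threshold\<close>

theorem theorem1p1:
  fixes p :: real
  assumes "1 < p" and "p < 2"
  shows "\<exists>f :: real \<Rightarrow> real \<Rightarrow> real.
    (\<forall>a>0. ivp_solution p a (f a) \<and>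
           (\<forall>g. ivp_solution p a g \<longrightarrow> (\<forall>r\<ge>0. g r = f a r)) \<and>
           0 < first_zero (f a)) \<and>
    (\<exists>a_star>0.
       (\<forall>a>a_star. first_zero (f a) < \<infinity> \<and>
          f a (real_of_ereal (first_zero (f a))) = 0 \<and>
          hderiv (f a) (real_of_ereal (first_zero (f a))) < 0) \<and>
       (first_zero (f a_star) = \<infinity> \<and>
          (\<exists>l_star>0. ((\<lambda>r. exp (r / (p - 1)) * f a_star r) \<longlongrightarrow> l_star) at_top)) \<and>
       (\<forall>a. 0 < a \<and> a < a_star \<longrightarrow> first_zero (f a) = \<infinity> \<and>
          ((\<lambda>r. r powr ((p - 1) / (2 - p)) * f a r)
             \<longlongrightarrow> ((p - 1) / (2 - p)) powr ((p - 1) / (2 - p))) at_top))"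
proof -
  define m where "m = 1 / (p - 1)"
  have m: "1 < m" using assms by (simp add: m_def)
  have "\<forall>a. \<exists>f w. trajectory m a f w" using trajectory_exists[OF m] by blast
  then obtain f w where fw: "\<And>a. trajectory m a (f a) (w a)" by metis
  define Pos where "Pos = {a. 0 < a \<and> (\<forall>t\<ge>0. 0 < f a t)}"
  define a_star where "a_star = Sup Pos"

  have trapped_Pos: "a \<in> Pos" if "trapped_at m (f a) (w a) s" "0 < a" for a s
    using trapped_forever(1)[OF m fw that(1)] that(2) by (auto simp: Pos_def)
  have below: "\<exists>s. trapped_at m (f a) (w a) s" if "0 < a" "a < b" "b \<in> Pos" for a b
    using that by (intro below_positive_trapped[OF m fw fw that(1,2)]) (auto simp: Pos_def)
  have bdd: "bdd_above Pos"
    using positive_initial_bounded[OF m fw] by (intro bdd_aboveI) (auto simp: Pos_def)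
  have small: "trap_level m / 2 \<in> Pos"
    using trap_level_pos[of m]
    by (intro trapped_Pos[of _ 0]) (auto simp: trapped_at_def trajectory_init[OF fw])
  have star_pos: "0 < a_star"
    using cSup_upper[OF small bdd] trap_level_pos[of m] by (simp add: a_star_def)
  have above: "a \<notin> Pos" if "a_star < a" for a
    using cSup_upper[OF _ bdd, of a] that by (auto simp: a_star_def)
  have trapped_below: "\<exists>s. trapped_at m (f a) (w a) s" if "0 < a" "a < a_star" for a
  proof -
    have "Pos \<noteq> {}" "a < Sup Pos" using small that(2) by (auto simp: a_star_def)
    from less_cSupD[OF this] obtain b where "b \<in> Pos" "a < b" by blast
    then show ?thesis using below[OF that(1)] by simp
  qed
  have star_Pos: "a_star \<in> Pos"
  proof (rule ccontr)
    assume "a_star \<notin> Pos"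
    then have "\<not> (\<forall>t\<ge>0. 0 < f a_star t)" using star_pos by (simp add: Pos_def)
    from nonpositive_open[OF m fw star_pos this]
    obtain d where "d > 0"
      and d: "\<forall>b g v. \<bar>b - a_star\<bar> < d \<longrightarrow> trajectory m b g v \<longrightarrow> \<not> (\<forall>t\<ge>0. 0 < g t)"
      by blast
    define b where "b = max (a_star / 2) (a_star - d / 2)"
    have b: "0 < b" "b < a_star" "\<bar>b - a_star\<bar> < d"
      using star_pos \<open>d > 0\<close> by (auto simp: b_def max_def)
    from trapped_below[OF b(1,2)] obtain s where "trapped_at m (f b) (w b) s" ..
    then have "b \<in> Pos" using b(1) by (rule trapped_Pos)
    then show False using d[rule_format, OF b(3) fw] by (simp add: Pos_def)
  qed
  have star_untrapped: "\<not> trapped_at m (f a_star) (w a_star) s" for s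
  proof
    assume "trapped_at m (f a_star) (w a_star) s"
    from trapped_open[OF m fw this]
    obtain d where "d > 0"
      and d: "\<forall>b g v. \<bar>b - a_star\<bar> < d \<longrightarrow> trajectory m b g v \<longrightarrow> trapped_at m g v s"
      by blast
    have "trapped_at m (f (a_star + d / 2)) (w (a_star + d / 2)) s"
      by (rule d[rule_format, OF _ fw]) (use \<open>d > 0\<close> in simp)
    then have "a_star + d / 2 \<in> Pos" by (rule trapped_Pos) (use star_pos \<open>d > 0\<close> in simp)
    then show False using above[of "a_star + d / 2"] \<open>d > 0\<close> by simp
  qed

  have zero: "\<exists>r>0. first_zero (f a) = ereal r \<and> f a r = 0 \<and> hderiv (f a) r < 0"
    if a: "0 < a" "a \<notin> Pos" for a
  proof -
    have "\<not> (\<forall>t\<ge>0. 0 < f a t)" using a by (simp add: Pos_def)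
    then obtain r where r: "0 < r" "f a r = 0" "0 < w a r" "\<And>t. 0 \<le> t \<Longrightarrow> t < r \<Longrightarrow> 0 < f a t"
      using trajectory_first_zero[OF m fw a(1)] by blast
    have "first_zero (f a) = ereal r"
    proof (rule first_zero_eq[where f = "f a", OF r(1,2)])
      show "f a t \<noteq> 0" if "0 < t" "t < r" for t using r(4)[of t] that by simp
    qed
    moreover have "hderiv (f a) r < 0"
      using trajectory_hderiv[OF fw, of r a] r by (simp add: p_power_pos)
    ultimately show ?thesis using r by blast
  qed
  have inf: "first_zero (f a) = \<infinity>" if "a \<in> Pos" for a
    using that by (intro first_zero_infinity) (simp add: Pos_def)

  have sol: "ivp_solution p a (f a) \<and> (\<forall>g. ivp_solution p a g \<longrightarrow> (\<forall>r\<ge>0. g r = f a r)) \<and> 0 < first_zero (f a)"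
    if a: "0 < a" for a
  proof (intro conjI allI impI)
    show "ivp_solution p a (f a)"
      by (rule trajectory_imp_ivp_solution[OF assms fw[unfolded m_def]])
    show "0 < first_zero (f a)"
      using zero[OF a] inf[of a] by (cases "a \<in> Pos") auto
    fix g and r :: real assume g: "ivp_solution p a g" and r: "0 \<le> r"
    show "g r = f a r"
      by (rule trajectory_unique(1)[OF m ivp_solution_imp_trajectory[OF assms g, folded m_def] fw r])
  qed
  have above_star: "first_zero (f a) < \<infinity> \<and> f a (real_of_ereal (first_zero (f a))) = 0 \<and>
      hderiv (f a) (real_of_ereal (first_zero (f a))) < 0" if a: "a_star < a" for a
  proof -
    obtain r where "first_zero (f a) = ereal r" "f a r = 0" "hderiv (f a) r < 0"
      using zero[of a] above[OF a] a star_pos by auto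
    then show ?thesis by simp
  qed
  have at_star: "\<exists>l_star>0. ((\<lambda>r. exp (r / (p - 1)) * f a_star r) \<longlongrightarrow> l_star) at_top"
  proof -
    have pos: "\<forall>t\<ge>0. 0 < f a_star t" using star_Pos by (simp add: Pos_def)
    obtain s where "\<forall>t\<ge>s. 2 * f a_star t \<le> w a_star t"
      using positive_untrapped_fast[OF m fw pos star_untrapped] by blast
    from positive_fast_decay[OF m fw pos this] show ?thesis by (simp add: m_def)
  qed
  have below_star: "first_zero (f a) = \<infinity> \<and> ((\<lambda>r. r powr ((p - 1) / (2 - p)) * f a r)
      \<longlongrightarrow> ((p - 1) / (2 - p)) powr ((p - 1) / (2 - p))) at_top" if a: "0 < a" "a < a_star" for a
  proof
    obtain s where s: "trapped_at m (f a) (w a) s" using trapped_below[OF a] by blast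
    show "first_zero (f a) = \<infinity>" by (rule inf[OF trapped_Pos[OF s a(1)]])
    have "\<forall>t\<ge>0. 0 < f a t" "\<forall>t\<ge>s. w a t < 2 * f a t"
      using trapped_forever[OF m fw s] by simp_all
    from positive_slow_decay[OF m fw this]
    have "((\<lambda>t. t powr (1 / (m - 1)) * f a t) \<longlongrightarrow> (1 / (m - 1)) powr (1 / (m - 1))) at_top" .
    moreover have "1 / (m - 1) = (p - 1) / (2 - p)"
      using assms by (simp add: m_def field_simps)
    ultimately show "((\<lambda>r. r powr ((p - 1) / (2 - p)) * f a r)
      \<longlongrightarrow> ((p - 1) / (2 - p)) powr ((p - 1) / (2 - p))) at_top" by simp
  qed
  show ?thesis
    by (rule exI[of _ f], rule conjI, use sol in blast, rule exI[of _ a_star])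
      (use star_pos above_star inf[OF star_Pos] at_star below_star in blast)
qed

end
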